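(* Let $(\varphi_t)_{t\ge0}$ be a non-elliptic semigroup in $\mathbb{D}$ with Denjoy–Wolff point $\tau\in\partial\mathbb{D}$, Koenigs function $h$, and planar domain $\Omega:=h(\mathbb{D})$. Fix some $p\in\mathsf{NP}(\Omega)$ and denote $$\alpha_p^-:=\liminf_{t\to+\infty}\alpha^-_{\Omega,p}(t)\in[0,\pi],\qquad \alpha_p^+:=\liminf_{t\to+\infty}\alpha^+_{\Omega,p}(t)\in[0,\pi].$$ Then the following assertions hold: (A) If $\alpha_p^->0$ and $\alpha_p^+>0$, then the trajectories $t\mapsto\varphi_t(z)$ converge to $\tau$ non-tangentially for all $z\in\mathbb{D}$. (B) If $\alpha_p^->0$ but $\alpha^+_{\Omega,p}(t)\to0$ as $t\to+\infty$, then $\mathrm{Slope}[t\mapsto\varphi_t(z),\tau]=\{\pi/2\}$ for every $z\in\mathbb{D}$. In particular, the trajectories $t\mapsto\varphi_t(z)$ converge to $\tau$ tangentially for all $z\in\mathbb{D}$. (C) If $\alpha_p^+>0$ but $\alpha^-_{\Omega,p}(t)\to0$ as $t\to+\infty$, then $\mathrm{Slope}[t\mapsto\varphi_t(z),\tau]=\{-\pi/2\}$ for every $z\in\mathbb{D}$. In particular, the trajectories $t\mapsto\varphi_t(z)$ converge to $\tau$ tangentially for all $z\in\mathbb{D}$.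
   Context: $\mathbb{D}$ is the open unit disk in $\mathbb{C}$. A semigroup in $\mathbb{D}$ is a family $(\varphi_t)_{t\ge0}$ of holomorphic maps $\varphi_t:\mathbb{D}\to\mathbb{D}$ with $\varphi_0=\mathrm{id}$, $\varphi_{s+t}=\varphi_s\circ\varphi_t$ for all $s,t\ge0$, and $t\mapsto\varphi_t$ continuous for the topology of uniform convergence on compacta. It is non-elliptic if no $\varphi_t$ with $t>0$ has a fixed point in $\mathbb{D}$; then there is a unique $\tau\in\partial\mathbb{D}$, the Denjoy–Wolff point (DW-point), with $\varphi_t(z)\to\tau$ as $t\to+\infty$ for all $z\in\mathbb{D}$. A Koenigs function of a non-elliptic semigroup is a univalent holomorphic map $h:\mathbb{D}\to\mathbb{C}$ such that $h(\varphi_t(z))=h(z)+it$ for all $z\in\mathbb{D}$, $t\ge0$; it exists and is unique up to an additive constant. The image $\Omega=h(\mathbb{D})$ is called the planar domain of the semigroup. It is starlike at infinity, i.e. $\Omega+it\subset\Omega$ for all $t\ge0$. Slope set: for $z\in\mathbb{D}$, $\mathrm{Slope}[t\mapsto\varphi_t(z),\tau]$ is the set of all $\theta\in[-\pi/2,\pi/2]$ for which there is a sequence $t_n\to+\infty$ with $\mathrm{Arg}(1-\overline{\tau}\varphi_{t_n}(z))\to\theta$, where $\mathrm{Arg}$ takes values in $(-\pi/2,\pi/2)$ here. Convergence of the trajectory is non-tangential if the slope set is a compact subset of $(-\pi/2,\pi/2)$, and tangential if the slope set is contained in $\{-\pi/2,\pi/2\}$. For a domain $\Omega\subset\mathbb{C}$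 starlike at infinity, $\mathsf{NP}(\Omega)$ (natural points) is the set of $p\in\mathbb{C}$ such that for some $t_0\ge0$, $p+it\in\Omega$ for all $t>t_0$. For $p\in\mathsf{NP}(\Omega)$ and $t>0$ with $p+it\in\Omega$, the left and right angular extents are $$\alpha^-_{\Omega,p}(t):=\min\{\pi,\ \sup\{\alpha>0: p+ite^{i\theta}\in\Omega\ \text{for all}\ \theta\in[0,\alpha]\}\},$$ $$\alpha^+_{\Omega,p}(t):=\min\{\pi,\ \sup\{\alpha>0: p+ite^{-i\theta}\in\Omega\ \text{for all}\ \theta\in[0,\alpha]\}\}.$$ They are considered on the interval $(t_0(p),+\infty)$, $t_0(p):=\inf\{t\ge0: p+it\in\Omega\}$. *)

theory Defs
  imports "HOL-Complex_Analysis.Complex_Analysis"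
begin

abbreviation unit_disk :: "complex set" where
  "unit_disk \<equiv> ball 0 1"

text \<open>The parameter of a semigroup is a real number; only the maps \<open>\<phi> t\<close> with \<open>t \<ge> 0\<close>,
  restricted to the unit disk, are meaningful.\<close>

definition semigroup_in_disk :: "(real \<Rightarrow> complex \<Rightarrow> complex) \<Rightarrow> bool" where
  "semigroup_in_disk \<phi> \<longleftrightarrow>
     (\<forall>t\<ge>0. \<phi> t holomorphic_on unit_disk \<and> \<phi> t ` unit_disk \<subseteq> unit_disk) \<and>
     (\<forall>z\<in>unit_disk. \<phi> 0 z = z) \<and>
     (\<forall>s\<ge>0. \<forall>t\<ge>0. \<forall>z\<in>unit_disk. \<phi> (s + t) z = \<phi> s (\<phi> t z)) \<and>
     (\<forall>t\<ge>0. \<forall>K. compact K \<and> K \<subseteq> unit_disk \<longrightarrow> uniform_limit K \<phi> (\<phi> t) (at t within {0..}))"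

definition nonelliptic_semigroup :: "(real \<Rightarrow> complex \<Rightarrow> complex) \<Rightarrow> bool" where
  "nonelliptic_semigroup \<phi> \<longleftrightarrow>
     semigroup_in_disk \<phi> \<and> (\<forall>t>0. \<forall>z\<in>unit_disk. \<phi> t z \<noteq> z)"

definition DW_point :: "(real \<Rightarrow> complex \<Rightarrow> complex) \<Rightarrow> complex \<Rightarrow> bool" where
  "DW_point \<phi> \<tau> \<longleftrightarrow> \<tau> \<in> sphere 0 1 \<and> (\<forall>z\<in>unit_disk. ((\<lambda>t. \<phi> t z) \<longlongrightarrow> \<tau>) at_top)"

definition koenigs_function :: "(real \<Rightarrow> complex \<Rightarrow> complex) \<Rightarrow> (complex \<Rightarrow> complex) \<Rightarrow> bool" where
  "koenigs_function \<phi> h \<longleftrightarrow>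
     h holomorphic_on unit_disk \<and> inj_on h unit_disk \<and>
     (\<forall>z\<in>unit_disk. \<forall>t\<ge>0. h (\<phi> t z) = h z + \<i> * of_real t)"

text \<open>For \<open>\<tau>\<close> on the unit circle and \<open>w\<close> in the disk, \<open>1 - cnj \<tau> * w\<close> has positive real part,
  so the principal argument below lies in the open interval from \<open>-pi/2\<close> to \<open>pi/2\<close>.\<close>

definition slope_set :: "(real \<Rightarrow> complex) \<Rightarrow> complex \<Rightarrow> real set" where
  "slope_set \<gamma> \<tau> =
     {\<theta> \<in> {-pi/2..pi/2}. \<exists>t :: nat \<Rightarrow> real. (\<forall>n. t n \<ge> 0) \<and> filterlim t at_top sequentially \<and>
        (\<lambda>n. Arg (1 - cnj \<tau> * \<gamma> (t n))) \<longlonglongrightarrow> \<theta>}"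

definition converges_nontangentially :: "(real \<Rightarrow> complex) \<Rightarrow> complex \<Rightarrow> bool" where
  "converges_nontangentially \<gamma> \<tau> \<longleftrightarrow>
     (\<gamma> \<longlongrightarrow> \<tau>) at_top \<and> compact (slope_set \<gamma> \<tau>) \<and> slope_set \<gamma> \<tau> \<subseteq> {-pi/2<..<pi/2}"

definition converges_tangentially :: "(real \<Rightarrow> complex) \<Rightarrow> complex \<Rightarrow> bool" where
  "converges_tangentially \<gamma> \<tau> \<longleftrightarrow>
     (\<gamma> \<longlongrightarrow> \<tau>) at_top \<and> slope_set \<gamma> \<tau> \<subseteq> {-pi/2, pi/2}"

definition natural_points :: "complex set \<Rightarrow> complex set" where
  "natural_points \<Omega> = {p. \<exists>t0\<ge>0. \<forall>t>t0. p + \<i> * of_real t \<in> \<Omega>}"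

text \<open>The suprema are taken in the extended reals because the set of admissible \<open>\<alpha>\<close> is unbounded
  when the whole circle around \<open>p\<close> lies in \<open>\<Omega>\<close>. The values are only meaningful for \<open>t > 0\<close> with
  \<open>p + \<i> * of_real t \<in> \<Omega>\<close>, which for a natural point \<open>p\<close> holds for all large \<open>t\<close>.\<close>

definition left_extent :: "complex set \<Rightarrow> complex \<Rightarrow> real \<Rightarrow> ereal" where
  "left_extent \<Omega> p t =
     min (ereal pi)
       (Sup (ereal ` {\<alpha>. \<alpha> > 0 \<and> (\<forall>\<theta>\<in>{0..\<alpha>}. p + \<i> * of_real t * exp (\<i> * of_real \<theta>) \<in> \<Omega>)}))"

definition right_extent :: "complex set \<Rightarrow> complex \<Rightarrow> real \<Rightarrow> ereal" where
  "right_extent \<Omega> p t =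
     min (ereal pi)
       (Sup (ereal ` {\<alpha>. \<alpha> > 0 \<and> (\<forall>\<theta>\<in>{0..\<alpha>}. p + \<i> * of_real t * exp (- \<i> * of_real \<theta>) \<in> \<Omega>)}))"

lemma extent_aux:
  fixes c :: complex
  assumes "open \<Omega>" "p + \<i> * of_real t \<in> \<Omega>"
  shows "Sup (ereal ` {\<alpha>. \<alpha> > 0 \<and> (\<forall>\<theta>\<in>{0..\<alpha>}. p + \<i> * of_real t * exp (c * of_real \<theta>) \<in> \<Omega>)}) > 0"
proof -
  let ?f = "\<lambda>\<theta>::real. p + \<i> * of_real t * exp (c * of_real \<theta>)"
  have "isCont ?f 0" by (intro continuous_intros)
  then have "\<forall>\<^sub>F \<theta> in at 0. ?f \<theta> \<in> \<Omega>"
    using assms unfolding isCont_def by (intro topological_tendstoD) auto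
  then obtain d where d: "d > 0" "\<And>\<theta>. \<theta> \<noteq> 0 \<Longrightarrow> \<bar>\<theta>\<bar> < d \<Longrightarrow> ?f \<theta> \<in> \<Omega>"
    unfolding eventually_at by (auto simp: dist_real_def)
  have "?f \<theta> \<in> \<Omega>" if "\<theta> \<in> {0..d/2}" for \<theta>
    using that d(1) d(2)[of \<theta>] assms(2) by (cases "\<theta> = 0") auto
  then have "ereal (d/2) \<le> Sup (ereal ` {\<alpha>. \<alpha> > 0 \<and> (\<forall>\<theta>\<in>{0..\<alpha>}. ?f \<theta> \<in> \<Omega>)})"
    using d(1) by (intro Sup_upper) auto
  moreover have "0 < ereal (d/2)" using d(1) by simp
  ultimately show ?thesis by order
qed

lemma extent_bounds:
  assumes "open \<Omega>" "p + \<i> * of_real t \<in> \<Omega>"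
  shows "left_extent \<Omega> p t \<in> {0<..ereal pi}" "right_extent \<Omega> p t \<in> {0<..ereal pi}"
  using extent_aux[OF assms, of \<i>] extent_aux[OF assms, of "-\<i>"]
  by (auto simp: left_extent_def right_extent_def)

lemma Liminf_extent_bounds:
  assumes "open \<Omega>" "p \<in> natural_points \<Omega>"
  shows "Liminf at_top (left_extent \<Omega> p) \<in> {0..ereal pi}"
    and "Liminf at_top (right_extent \<Omega> p) \<in> {0..ereal pi}"
proof -
  have ev: "\<forall>\<^sub>F t in at_top. p + \<i> * of_real t \<in> \<Omega>"
    using assms(2) by (auto simp: natural_points_def eventually_at_top_dense)
  have l: "\<forall>\<^sub>F t in at_top. left_extent \<Omega> p t \<in> {0<..ereal pi}"
    and r: "\<forall>\<^sub>F t in at_top. right_extent \<Omega> p t \<in> {0<..ereal pi}"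
    using ev by (eventually_elim, use extent_bounds[OF assms(1)] in blast)+
  have *: "Liminf at_top f \<in> {0..ereal pi}"
    if f: "\<forall>\<^sub>F t in at_top. f t \<in> {0<..ereal pi}" for f :: "real \<Rightarrow> ereal"
  proof -
    have "0 \<le> Liminf at_top f"
      by (rule Liminf_bounded) (use f in eventually_elim, auto)
    moreover have "Limsup at_top f \<le> ereal pi"
      by (rule Limsup_bounded) (use f in eventually_elim, auto)
    ultimately show ?thesis
      using Liminf_le_Limsup[of "at_top :: real filter" f] by auto
  qed
  show "Liminf at_top (left_extent \<Omega> p) \<in> {0..ereal pi}" by (rule *[OF l])
  show "Liminf at_top (right_extent \<Omega> p) \<in> {0..ereal pi}" by (rule *[OF r])
qed

end

theory Submission
  imports Defs "HOL-Real_Asymp.Real_Asymp"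
begin

text \<open>
  The Cayley transform of the disk that sends \<open>\<tau>\<close> to infinity, composed with the inverse of the Koenigs
  function, is a conformal map \<open>f\<close> of \<open>\<Omega>\<close> onto the right half-plane. Along a trajectory it tends to
  infinity, and the slope is read off from the ratio \<open>Im f / Re f\<close>: trajectories are non-tangential
  when this ratio stays bounded, and the slope is \<open>pi/2\<close> when it tends to minus infinity. In this model
  the dynamics is translation \<open>w \<mapsto> w + \<i> s\<close> on \<open>\<Omega>\<close>, and Julia's lemma at the Denjoy-Wolff
  point (\<open>half_plane_Julia\<close>) says that \<open>Re f\<close> increases upwards, hence \<open>Im f\<close> increases to
  the left. This monotonicity and the Schwarz-Pick inequality carry the whole proof. Trajectories of
  different points stay at bounded hyperbolic distance, so it suffices to follow the vertical
  half-line above \<open>p\<close>; below, \<open>p = 0\<close>.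

  Wide on both sides. The distance from \<open>\<i> t\<close> to the boundary is at least \<open>\<kappa> t\<close>, so
  \<open>|f'| \<le> 2 Re f / (\<kappa> t)\<close> on the axis, and \<open>Im f\<close> changes by at most a constant
  times \<open>Re f\<close> when \<open>t\<close> is multiplied by a constant. On the other hand \<open>\<Omega>\<close> omits a
  downward half-line, so it lies in a slit plane; there, the hyperbolic distance between \<open>\<i> t\<close> and
  \<open>\<i> L t\<close> grows like \<open>log L\<close>, which is more than the imaginary part can account for. So
  \<open>Re f\<close> doubles between \<open>t\<close> and \<open>L t\<close>, and summing a geometric series bounds
  \<open>Im f\<close> by a multiple of \<open>Re f\<close> (\<open>nontangential_if_wide_on_both_sides\<close>).

  Wide on the left, narrow on the right. Let \<open>X t\<close> be the value of \<open>Re f\<close> at height \<open>t\<close>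
  well inside the sector on the left. Monotonicity excludes that \<open>Re f\<close> blows up near the axis
  (\<open>Carleson\<close>, \<open>P_le_X\<close>), and the slit-plane comparison then shows that it is much smaller
  than \<open>X t\<close> near the axis (\<open>P_small_near_axis\<close>), as it should be near a boundary arc that
  is mapped to the imaginary axis. So \<open>Re f\<close> increases rapidly to the left, and by the
  Cauchy-Riemann equations \<open>Im f\<close> decreases upwards, by an amount comparable to \<open>X t\<close> over
  a height comparable to \<open>t\<close>. Hence \<open>Im f \<le> C - c X\<close> while \<open>Re f = o(X)\<close> on the axis
  (\<open>tangential_if_narrow_on_the_right\<close>). The case of the other side follows by reflection.
\<close>

section \<open>The Schwarz-Pick inequality for the right half-plane\<close>

lemma norm_half_plane_identity:
  fixes a b :: complex
  shows "(norm (a + cnj b))\<^sup>2 = (norm (a - b))\<^sup>2 + 4 * Re a * Re b"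
  unfolding cmod_power2 by (simp add: power2_eq_square algebra_simps)

lemma norm_add_cnj_sq:
  fixes a b :: complex
  shows "(norm (a + cnj b))\<^sup>2 = (Re a + Re b)\<^sup>2 + (Im a - Im b)\<^sup>2"
  by (simp add: cmod_power2)

lemma norm_add_cnj_pos:
  fixes a b :: complex
  assumes "0 < Re a" "0 < Re b"
  shows "0 < norm (a + cnj b)"
proof -
  have "Re (a + cnj b) > 0" using assms by simp
  then show ?thesis by (metis complex_Re_le_cmod less_le_trans)
qed

lemma norm_diff_less_norm_add_cnj:
  fixes a b :: complex
  assumes "0 < Re a" "0 < Re b"
  shows "norm (a - b) < norm (a + cnj b)"
proof -
  have "(norm (a - b))\<^sup>2 < (norm (a + cnj b))\<^sup>2"
    using norm_half_plane_identity[of a b] assms by simp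
  then show ?thesis by (rule power2_less_imp_less) simp
qed

lemma norm_Complex_diff_sq: "(norm (Complex a b - Complex c d))\<^sup>2 = (a - c)\<^sup>2 + (b - d)\<^sup>2"
  by (simp add: cmod_power2)

text \<open>The Schwarz lemma for maps from a disk to the half-plane: the target is moved to the unit disk by the
  Moebius map \<open>b \<mapsto> (b - F c) / (b + cnj (F c))\<close>.\<close>

lemma disk_half_plane_Schwarz:
  assumes hol: "F holomorphic_on ball c r" and r: "0 < r"
    and pos: "\<And>z. z \<in> ball c r \<Longrightarrow> 0 < Re (F z)"
  shows "z \<in> ball c r \<Longrightarrow> r * norm (F z - F c) \<le> norm (z - c) * norm (F z + cnj (F c))"
    and "r * norm (deriv F c) \<le> 2 * Re (F c)"
proof -
  define \<psi> where "\<psi> \<zeta> = c + of_real r * \<zeta>" for \<zeta> :: complex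
  define k where "k \<zeta> = (F (\<psi> \<zeta>) - F c) / (F (\<psi> \<zeta>) + cnj (F c))" for \<zeta>
  have c: "0 < Re (F c)" using pos r by simp
  have im: "\<psi> \<zeta> \<in> ball c r" if "norm \<zeta> < 1" for \<zeta>
    using that r by (simp add: \<psi>_def dist_norm norm_mult)
  have nz: "F (\<psi> \<zeta>) + cnj (F c) \<noteq> 0" if "norm \<zeta> < 1" for \<zeta>
    using norm_add_cnj_pos[OF pos[OF im[OF that]] c] by auto
  have "(\<lambda>\<zeta>. F (\<psi> \<zeta>)) holomorphic_on ball 0 1"
    by (rule holomorphic_on_compose_gen[OF _ hol, unfolded o_def])
       (use im in \<open>auto simp: \<psi>_def intro!: holomorphic_intros\<close>)
  then have holk: "k holomorphic_on ball 0 1"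
    unfolding k_def using nz by (intro holomorphic_intros) auto
  have k0: "k 0 = 0" by (simp add: k_def \<psi>_def)
  have k1: "norm (k \<zeta>) < 1" if "norm \<zeta> < 1" for \<zeta>
  proof -
    have "norm (F (\<psi> \<zeta>) - F c) < norm (F (\<psi> \<zeta>) + cnj (F c))"
      by (rule norm_diff_less_norm_add_cnj[OF pos[OF im[OF that]] c])
    moreover have "0 < norm (F (\<psi> \<zeta>) + cnj (F c))" using nz[OF that] by simp
    ultimately show ?thesis by (simp add: k_def norm_divide)
  qed
  show "r * norm (F z - F c) \<le> norm (z - c) * norm (F z + cnj (F c))" if z: "z \<in> ball c r"
  proof -
    define \<zeta> where "\<zeta> = (z - c) / of_real r"
    have nz\<zeta>: "norm \<zeta> < 1" and \<psi>: "\<psi> \<zeta> = z" and n\<zeta>: "norm \<zeta> = norm (z - c) / r"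
      using z r by (auto simp: \<zeta>_def \<psi>_def norm_divide dist_norm norm_minus_commute)
    have "norm (k \<zeta>) \<le> norm \<zeta>" by (rule Schwarz_Lemma(1)[OF holk k0 k1 nz\<zeta>])
    moreover have "0 < norm (F z + cnj (F c))" using nz[OF nz\<zeta>] \<psi> by simp
    ultimately show ?thesis using r
      by (simp add: k_def \<psi> n\<zeta> norm_divide divide_simps mult.commute)
  qed
  show "r * norm (deriv F c) \<le> 2 * Re (F c)"
  proof -
    have dF: "(F has_field_derivative deriv F c) (at c)"
      using hol r by (intro holomorphic_derivI) auto
    have "(F has_field_derivative deriv F c) (at (\<psi> 0))" using dF by (simp add: \<psi>_def)
    moreover have "(\<psi> has_field_derivative of_real r) (at 0)"
      unfolding \<psi>_def by (auto intro!: derivative_eq_intros)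
    ultimately have d\<psi>: "((\<lambda>\<zeta>. F (\<psi> \<zeta>)) has_field_derivative deriv F c * of_real r) (at 0)"
      by (rule DERIV_chain2)
    have "(k has_field_derivative
        (deriv F c * of_real r * (F (\<psi> 0) + cnj (F c)) - (F (\<psi> 0) - F c) * (deriv F c * of_real r))
         / ((F (\<psi> 0) + cnj (F c)) * (F (\<psi> 0) + cnj (F c)))) (at 0)"
      unfolding k_def
      by (rule DERIV_divide) (use nz[of 0] in \<open>auto intro!: derivative_eq_intros d\<psi>\<close>)
    then have "deriv k 0 = (deriv F c * of_real r) / (F (\<psi> 0) + cnj (F c))"
      using nz[of 0] by (simp add: DERIV_imp_deriv \<psi>_def)
    also have "F (\<psi> 0) + cnj (F c) = of_real (2 * Re (F c))"
      by (simp add: \<psi>_def complex_add_cnj)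
    finally have "norm (deriv k 0) = norm (deriv F c) * r / (2 * Re (F c))"
      using r c by (simp add: norm_divide norm_mult)
    moreover have "norm (deriv k 0) \<le> 1" by (rule Schwarz_Lemma(2)[OF holk k0 k1, of 0]) auto
    ultimately have "norm (deriv F c) * r / (2 * Re (F c)) \<le> 1" by simp
    then show ?thesis using c by (simp add: divide_le_eq mult.commute)
  qed
qed

text \<open>Harnack's inequality with non-optimal constants. It is stated for the squared distance because the
  points compared below are given by their coordinates. It follows from the Schwarz lemma since
  \<open>|F z + cnj (F c)|\<close> is at least \<open>Re (F z) + Re (F c)\<close>.\<close>

lemma half_plane_Harnack:
  assumes hol: "F holomorphic_on ball c r" and r: "0 < r"
    and pos: "\<And>z. z \<in> ball c r \<Longrightarrow> 0 < Re (F z)"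
    and q: "(norm (z - c))\<^sup>2 \<le> q * r\<^sup>2" "q < 1"
  shows "(1 - q) * Re (F z) \<le> 4 * Re (F c)" and "(1 - q) * Re (F c) \<le> 4 * Re (F z)"
proof -
  let ?a = "Re (F z)" and ?b = "Re (F c)" and ?n = "(norm (F z + cnj (F c)))\<^sup>2"
  have "q * r\<^sup>2 < 1 * r\<^sup>2" using q(2) r by (intro mult_strict_right_mono) auto
  then have "(norm (z - c))\<^sup>2 < r\<^sup>2" using q(1) by linarith
  then have "norm (z - c) < r" by (rule power2_less_imp_less) (use r in auto)
  then have z: "z \<in> ball c r" by (simp add: dist_norm norm_minus_commute)
  have a: "0 < ?a" and b: "0 < ?b" using pos z r by auto
  have "(r * norm (F z - F c))\<^sup>2 \<le> (norm (z - c) * norm (F z + cnj (F c)))\<^sup>2"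
    by (rule power_mono[OF disk_half_plane_Schwarz(1)[OF hol r pos z]]) (use r in auto)
  also have "\<dots> \<le> q * r\<^sup>2 * ?n"
    unfolding power_mult_distrib by (rule mult_right_mono[OF q(1)]) simp
  finally have "r\<^sup>2 * (?n - 4 * ?a * ?b) \<le> r\<^sup>2 * (q * ?n)"
    using norm_half_plane_identity[of "F z" "F c"] by (simp add: power_mult_distrib mult_ac)
  then have "?n - 4 * ?a * ?b \<le> q * ?n" using r by (simp add: mult_le_cancel_left)
  then have *: "(1 - q) * ?n \<le> 4 * ?a * ?b" by (simp add: algebra_simps)
  have n: "?n \<ge> (?a + ?b)\<^sup>2" by (simp add: norm_add_cnj_sq)
  have "?a * ?a \<le> (?a + ?b)\<^sup>2" "?b * ?b \<le> (?a + ?b)\<^sup>2"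
    using a b by (auto simp: power2_eq_square algebra_simps)
  then have "?a * ?a \<le> ?n" "?b * ?b \<le> ?n" using n by linarith+
  then have "(1 - q) * (?a * ?a) \<le> (1 - q) * ?n" "(1 - q) * (?b * ?b) \<le> (1 - q) * ?n"
    using q(2) by (auto intro!: mult_left_mono)
  then have "(1 - q) * (?a * ?a) \<le> 4 * ?a * ?b" "(1 - q) * (?b * ?b) \<le> 4 * ?a * ?b"
    using * by linarith+
  then have "?a * ((1 - q) * ?a) \<le> ?a * (4 * ?b)" "?b * ((1 - q) * ?b) \<le> ?b * (4 * ?a)"
    by (simp_all add: mult_ac)
  then show "(1 - q) * ?a \<le> 4 * ?b" "(1 - q) * ?b \<le> 4 * ?a"
    using a b by (simp_all add: mult_le_cancel_left)
qed

text \<open>The quantity \<open>Re a * Re b / |a + cnj b|^2\<close> is a decreasing function of the hyperbolic distance of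
  \<open>a\<close> and \<open>b\<close>, so this is the contraction property of holomorphic self-maps, free of denominators.
  It is the Schwarz lemma applied to \<open>F\<close> after the map \<open>T\<close> of the unit disk onto the half-plane
  with \<open>T 0 = b\<close>.\<close>

lemma half_plane_Schwarz_Pick:
  assumes hol: "F holomorphic_on {z. 0 < Re z}"
    and pos: "\<And>z. 0 < Re z \<Longrightarrow> 0 < Re (F z)"
    and a: "0 < Re a" and b: "0 < Re b"
  shows "Re a * Re b * (norm (F a + cnj (F b)))\<^sup>2 \<le> Re (F a) * Re (F b) * (norm (a + cnj b))\<^sup>2"
proof -
  \<comment> \<open>The Cayley-type map of the unit disk onto the half-plane that sends 0 to b.\<close>
  define T where "T \<zeta> = (b + cnj b * \<zeta>) / (1 - \<zeta>)" for \<zeta>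
  have ReT: "0 < Re (T \<zeta>)" if "\<zeta> \<in> ball 0 1" for \<zeta>
  proof -
    have n: "norm \<zeta> < 1" using that by simp
    then have ne: "1 - \<zeta> \<noteq> 0" by auto
    have sq: "(norm \<zeta>)\<^sup>2 < 1" using n by (simp add: abs_square_less_1)
    have "T \<zeta> = (b + cnj b * \<zeta>) * cnj (1 - \<zeta>) / of_real ((norm (1 - \<zeta>))\<^sup>2)"
      unfolding T_def by (rule complex_div_cnj)
    moreover have "Re ((b + cnj b * \<zeta>) * cnj (1 - \<zeta>)) = Re b * (1 - (norm \<zeta>)\<^sup>2)"
      unfolding cmod_power2 by (simp add: power2_eq_square algebra_simps)
    ultimately have "Re (T \<zeta>) = Re b * (1 - (norm \<zeta>)\<^sup>2) / (norm (1 - \<zeta>))\<^sup>2"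
      by (metis Re_divide_of_real)
    then show ?thesis using b sq ne by simp
  qed
  define \<zeta> where "\<zeta> = (a - b) / (a + cnj b)"
  have nz: "a + cnj b \<noteq> 0" using norm_add_cnj_pos[OF a b] by auto
  have \<zeta>: "\<zeta> \<in> ball 0 1"
    using norm_diff_less_norm_add_cnj[OF a b] nz by (simp add: \<zeta>_def norm_divide)
  have T0: "T 0 = b" by (simp add: T_def)
  have T\<zeta>: "T \<zeta> = a"
  proof -
    have "1 - \<zeta> = (b + cnj b) / (a + cnj b)" using nz by (simp add: \<zeta>_def field_simps)
    moreover have "b + cnj b * \<zeta> = a * (b + cnj b) / (a + cnj b)"
      using nz by (simp add: \<zeta>_def field_simps)
    moreover have "b + cnj b \<noteq> 0" using norm_add_cnj_pos[OF b b] by auto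
    ultimately show ?thesis using nz by (simp add: T_def)
  qed
  have "T holomorphic_on ball 0 1"
    unfolding T_def by (intro holomorphic_intros) auto
  then have "(\<lambda>\<zeta>. F (T \<zeta>)) holomorphic_on ball 0 1"
    by (rule holomorphic_on_compose_gen[OF _ hol, unfolded o_def]) (use ReT in auto)
  from disk_half_plane_Schwarz(1)[OF this _ pos[OF ReT] \<zeta>]
  have "norm (F a - F b) \<le> norm \<zeta> * norm (F a + cnj (F b))" by (simp add: T0 T\<zeta>)
  then have "norm (a + cnj b) * norm (F a - F b) \<le> norm (a - b) * norm (F a + cnj (F b))"
    using nz by (simp add: \<zeta>_def norm_divide divide_simps mult_ac)
  then have "(norm (a + cnj b))\<^sup>2 * (norm (F a - F b))\<^sup>2 \<le> (norm (a - b))\<^sup>2 * (norm (F a + cnj (F b)))\<^sup>2"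
    unfolding power_mult_distrib[symmetric] by (rule power_mono) simp
  then show ?thesis
    using norm_half_plane_identity[of a b] norm_half_plane_identity[of "F a" "F b"]
    by (simp add: algebra_simps)
qed

lemma has_real_derivative_along:
  assumes "(F has_field_derivative D) (at (\<gamma> t))" "(\<gamma> has_vector_derivative d) (at t)"
  shows "((\<lambda>s. Re (F (\<gamma> s))) has_real_derivative Re (d * D)) (at t)"
    and "((\<lambda>s. Im (F (\<gamma> s))) has_real_derivative Im (d * D)) (at t)"
proof -
  have "((F \<circ> \<gamma>) has_vector_derivative d * D) (at t)"
    using field_vector_diff_chain_at[OF assms(2,1)] by simp
  then show "((\<lambda>s. Re (F (\<gamma> s))) has_real_derivative Re (d * D)) (at t)"
    and "((\<lambda>s. Im (F (\<gamma> s))) has_real_derivative Im (d * D)) (at t)"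
    by (auto simp: has_vector_derivative_complex_iff)
qed

lemma vertical_line_deriv: "((\<lambda>r. Complex a r) has_vector_derivative \<i>) (at r within X)"
  by (simp add: has_vector_derivative_complex_iff)

lemma horizontal_line_deriv: "((\<lambda>v. Complex (- v) b) has_vector_derivative -1) (at r within X)"
  by (auto simp: has_vector_derivative_complex_iff intro!: derivative_eq_intros)

section \<open>A lower bound for positive harmonic functions on a triangle\<close>

text \<open>A substitute for harmonic measure. \<open>D\<close> is a right isosceles triangle with a vertical hypotenuse of
  length \<open>2 s\<close> on the line \<open>Re w = -u\<close>, lying to the left of it. A function with nonnegative real part that is at
  least \<open>m\<close> on the hypotenuse dominates \<open>m\<close> times the harmonic function \<open>Re v\<close>, because
  \<open>Re v\<close> vanishes on the legs and is at most \<open>1\<close> on the hypotenuse. The factor \<open>1/4\<close> is the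
  value of \<open>Re v\<close> at the midpoint of the altitude.\<close>

lemma triangle_lower_bound:
  fixes F :: "complex \<Rightarrow> complex" and t u s :: real
  defines "D \<equiv> {w. - Re w \<ge> u \<and> \<bar>Im w - (t + s)\<bar> \<le> s - (- Re w - u)}"
  assumes hol: "F holomorphic_on D" and s: "0 < s"
    and pos: "\<And>w. w \<in> D \<Longrightarrow> 0 \<le> Re (F w)"
    and base: "\<And>w. w \<in> D \<Longrightarrow> - Re w = u \<Longrightarrow> m \<le> Re (F w)" and m: "0 \<le> m"
  shows "m / 4 \<le> Re (F (Complex (- u - s/2) (t + s)))"
proof -
  define S where "S = {w. - Re w > u \<and> \<bar>Im w - (t + s)\<bar> < s - (- Re w - u)}"
  define z0 where "z0 = Complex (- u) (t + s)"
  define v where "v w = (1 + (w - z0) / of_real s)\<^sup>2" for w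
  have Rev: "Re (v w) = (1 - (- Re w - u) / s)\<^sup>2 - ((Im w - (t + s)) / s)\<^sup>2" for w
  proof -
    have "(w - z0) / of_real s = Complex ((Re w + u) / s) ((Im w - (t + s)) / s)"
      using s by (simp add: z0_def complex_eq_iff)
    then show ?thesis by (simp add: v_def Re_power2 algebra_simps diff_divide_distrib add_divide_distrib)
  qed
  have clD: "closed D" unfolding D_def
    by (intro closed_Collect_conj closed_Collect_le continuous_intros)
  have opS: "open S" unfolding S_def
    by (intro open_Collect_conj open_Collect_less continuous_intros)
  have SD: "S \<subseteq> D" by (auto simp: S_def D_def)
  have clSD: "closure S \<subseteq> D" using SD clD by (rule closure_minimal)
  have bnd: "bounded S"
  proof (rule boundedI)
    fix w assume "w \<in> S"
    then have "\<bar>Re w\<bar> \<le> \<bar>u\<bar> + s" "\<bar>Im w\<bar> \<le> \<bar>t + s\<bar> + s" by (auto simp: S_def)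
    then show "norm w \<le> (\<bar>u\<bar> + s) + (\<bar>t + s\<bar> + s)" using cmod_le[of w] by linarith
  qed
  have fr: "Re (of_real m * v w - F w) \<le> 0" if "w \<in> frontier S" for w
  proof -
    have wD: "w \<in> D" and wS: "w \<notin> S"
      using that clSD opS by (auto simp: frontier_def interior_open)
    have bd: "- Re w - u \<le> s" using wD by (auto simp: D_def)
    show ?thesis
    proof (cases "- Re w = u")
      case True
      have "Re (v w) \<le> 1" by (simp add: Rev True)
      then have "m * Re (v w) \<le> m" using m by (simp add: mult_left_le)
      then show ?thesis using base[OF wD True] by simp
    next
      case False
      then have "\<bar>Im w - (t + s)\<bar> = s - (- Re w - u)" using wD wS by (auto simp: D_def S_def)
      then have "(Im w - (t + s))\<^sup>2 = (s - (- Re w - u))\<^sup>2" by (metis power2_abs)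
      then have "Re (v w) = 0" using s by (simp add: Rev power_divide field_simps)
      then show ?thesis using pos[OF wD] by simp
    qed
  qed
  have hol2: "(\<lambda>w. of_real m * v w - F w) holomorphic_on D"
    unfolding v_def using s by (intro holomorphic_intros hol) auto
  have c: "Complex (- u - s/2) (t + s) \<in> S" using s by (simp add: S_def)
  have "Re (of_real m * v (Complex (- u - s/2) (t + s)) - F (Complex (- u - s/2) (t + s))) \<le> 0"
    by (rule maximum_real_frontier[OF _ _ bnd fr c])
       (use hol2 SD clSD opS in \<open>auto simp: interior_open intro: holomorphic_on_subset
          holomorphic_on_imp_continuous_on continuous_on_subset\<close>)
  moreover have "Re (v (Complex (- u - s/2) (t + s))) = 1/4"
    using s by (simp add: Rev power2_eq_square)
  ultimately show ?thesis by simp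
qed

text \<open>Both \<open>y + C ln\<close> and \<open>C ln - y\<close> are nondecreasing.\<close>

lemma log_growth_bound:
  fixes y y' :: "real \<Rightarrow> real"
  assumes st: "0 < s" "s \<le> t"
    and dy: "\<And>r. s \<le> r \<Longrightarrow> r \<le> t \<Longrightarrow> (y has_real_derivative y' r) (at r)"
    and bd: "\<And>r. s \<le> r \<Longrightarrow> r \<le> t \<Longrightarrow> \<bar>y' r\<bar> \<le> C / r"
  shows "\<bar>y t - y s\<bar> \<le> C * ln (t / s)"
proof -
  have "y s + C * ln s \<le> y t + C * ln t"
  proof (rule DERIV_nonneg_imp_nondecreasing[OF st(2)])
    fix r assume r: "s \<le> r" "r \<le> t"
    have "((\<lambda>r. y r + C * ln r) has_real_derivative y' r + C * (1 / r)) (at r)"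
      using r st by (auto intro!: derivative_eq_intros dy)
    moreover have "0 \<le> y' r + C * (1 / r)" using bd[OF r] by auto
    ultimately show "\<exists>d. ((\<lambda>r. y r + C * ln r) has_real_derivative d) (at r) \<and> 0 \<le> d" by blast
  qed
  moreover have "y t - C * ln t \<le> y s - C * ln s"
  proof (rule DERIV_nonpos_imp_nonincreasing[OF st(2)])
    fix r assume r: "s \<le> r" "r \<le> t"
    have "((\<lambda>r. y r - C * ln r) has_real_derivative y' r - C * (1 / r)) (at r)"
      using r st by (auto intro!: derivative_eq_intros dy)
    moreover have "y' r - C * (1 / r) \<le> 0" using bd[OF r] by auto
    ultimately show "\<exists>d. ((\<lambda>r. y r - C * ln r) has_real_derivative d) (at r) \<and> d \<le> 0" by blast
  qed
  moreover have "ln (t / s) = ln t - ln s" using st by (simp add: ln_div)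
  ultimately show ?thesis unfolding abs_le_iff by (simp add: right_diff_distrib)
qed

section \<open>Half-plane maps of domains starlike at infinity\<close>

text \<open>The setting into which the semigroup is translated: \<open>f\<close> and \<open>g\<close> are mutually inverse conformal
  maps between \<open>\<Omega>\<close> and the right half-plane. The last assumption is the form that Julia's lemma takes when the
  Denjoy-Wolff point corresponds to infinity.\<close>

locale starlike_half_plane_map =
  fixes \<Omega> :: "complex set" and f g :: "complex \<Rightarrow> complex"
  assumes open_domain: "open \<Omega>"
    and starlike: "w \<in> \<Omega> \<Longrightarrow> 0 \<le> s \<Longrightarrow> w + \<i> * of_real s \<in> \<Omega>"
    and holf: "f holomorphic_on \<Omega>"
    and Re_pos: "w \<in> \<Omega> \<Longrightarrow> 0 < Re (f w)"
    and holg: "g holomorphic_on {z. 0 < Re z}"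
    and g_in: "0 < Re z \<Longrightarrow> g z \<in> \<Omega>"
    and gf: "w \<in> \<Omega> \<Longrightarrow> g (f w) = w"
    and fg: "0 < Re z \<Longrightarrow> f (g z) = z"
    and Re_mono: "w \<in> \<Omega> \<Longrightarrow> 0 \<le> s \<Longrightarrow> Re (f w) \<le> Re (f (w + \<i> * of_real s))"
begin

lemma f_deriv: "w \<in> \<Omega> \<Longrightarrow> (f has_field_derivative deriv f w) (at w)"
  using holf open_domain by (rule holomorphic_derivI)

lemma Re_mono':
  assumes "Complex a b \<in> \<Omega>" "b \<le> b'"
  shows "Re (f (Complex a b)) \<le> Re (f (Complex a b'))"
proof -
  have "Complex a b + \<i> * of_real (b' - b) = Complex a b'" by (simp add: complex_eq_iff)
  with Re_mono[OF assms(1), of "b' - b"] assms(2) show ?thesis by simp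
qed

text \<open>The vertical derivative of \<open>Re f\<close> is \<open>Re (\<i> f') = - Im f'\<close>. By the Cauchy-Riemann equations
  this also says that \<open>Im f\<close> does not decrease when moving to the left.\<close>

lemma Im_deriv_nonpos:
  assumes "w \<in> \<Omega>" shows "Im (deriv f w) \<le> 0"
proof (rule ccontr)
  assume "\<not> Im (deriv f w) \<le> 0"
  moreover have w: "Complex (Re w) (Im w) = w" by simp
  have "((\<lambda>s. Re (f (Complex (Re w) s))) has_real_derivative Re (\<i> * deriv f w)) (at (Im w))"
    by (rule has_real_derivative_along(1)[OF _ vertical_line_deriv]) (use f_deriv[OF assms] w in simp)
  ultimately obtain d where d: "d > 0"
    "\<And>h. 0 < h \<Longrightarrow> h < d \<Longrightarrow> Re (f (Complex (Re w) (Im w + h))) < Re (f (Complex (Re w) (Im w)))"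
    using DERIV_neg_dec_right[of "\<lambda>s. Re (f (Complex (Re w) s))" "Re (\<i> * deriv f w)" "Im w"] by auto
  have "Re (f (Complex (Re w) (Im w))) \<le> Re (f (Complex (Re w) (Im w + d/2)))"
    by (rule Re_mono') (use d w assms in auto)
  with d(2)[of "d/2"] d(1) show False by simp
qed

lemma deriv_bound:
  assumes "ball w r \<subseteq> \<Omega>" "0 < r"
  shows "r * norm (deriv f w) \<le> 2 * Re (f w)"
  by (rule disk_half_plane_Schwarz(2)) (use assms holf Re_pos in \<open>auto intro: holomorphic_on_subset\<close>)

lemma Harnack:
  assumes "ball w r \<subseteq> \<Omega>" "0 < r" "(norm (z - w))\<^sup>2 \<le> q * r\<^sup>2" "q < 1"
  shows "(1 - q) * Re (f z) \<le> 4 * Re (f w)" "(1 - q) * Re (f w) \<le> 4 * Re (f z)"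
  using half_plane_Harnack[OF holomorphic_on_subset[OF holf assms(1)] assms(2) _ assms(3,4)]
    assms(1) Re_pos by blast+

text \<open>A domain starlike at infinity that omits \<open>q\<close> omits the half-line below \<open>q\<close>, so a branch \<open>\<sigma>\<close>
  of \<open>sqrt (- \<i> (z - q))\<close> maps it into the right half-plane. The hyperbolic distance of two points in
  \<open>\<Omega>\<close> is thus at least that of their images under \<open>\<sigma>\<close>, which is large when their distances to
  \<open>q\<close> are very different.\<close>

lemma slit_comparison:
  assumes q: "q \<notin> \<Omega>" and v: "v \<in> \<Omega>" and w: "w \<in> \<Omega>" and far: "16 * norm (v - q) \<le> norm (w - q)"
  shows "Re (f v) * Re (f w) * sqrt (norm (w - q))
           \<le> 4 * sqrt (norm (v - q)) * (norm (f v + cnj (f w)))\<^sup>2"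
proof -
  define \<sigma> where "\<sigma> z = csqrt (- \<i> * (z - q))" for z
  have slit: "- \<i> * (z - q) \<notin> \<real>\<^sub>\<le>\<^sub>0" if "z \<in> \<Omega>" for z
  proof
    assume "- \<i> * (z - q) \<in> \<real>\<^sub>\<le>\<^sub>0"
    then have "Re z = Re q" "Im z \<le> Im q" by (auto simp: complex_nonpos_Reals_iff)
    then have "z + \<i> * of_real (Im q - Im z) = q" by (simp add: complex_eq_iff)
    with starlike[OF that, of "Im q - Im z"] \<open>Im z \<le> Im q\<close> q show False by simp
  qed
  have pos: "0 < Re (\<sigma> z)" if "z \<in> \<Omega>" for z
  proof (rule ccontr)
    assume "\<not> 0 < Re (\<sigma> z)"
    then have "Re (\<sigma> z) = 0" using Re_csqrt[of "- \<i> * (z - q)"] by (simp add: \<sigma>_def del: csqrt.simps)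
    then have "(\<sigma> z)\<^sup>2 \<in> \<real>\<^sub>\<le>\<^sub>0" by (simp add: complex_nonpos_Reals_iff power2_eq_square)
    then show False using slit[OF that] unfolding \<sigma>_def power2_csqrt by contradiction
  qed
  have n\<sigma>: "norm (\<sigma> z) = sqrt (norm (z - q))" for z
    by (simp add: \<sigma>_def norm_mult del: csqrt.simps)
  have "(\<lambda>z. \<sigma> (g z)) holomorphic_on {z. 0 < Re z}"
    unfolding \<sigma>_def using slit g_in by (intro holomorphic_intros holg) auto
  then have "Re (f v) * Re (f w) * (norm (\<sigma> (g (f v)) + cnj (\<sigma> (g (f w)))))\<^sup>2
     \<le> Re (\<sigma> (g (f v))) * Re (\<sigma> (g (f w))) * (norm (f v + cnj (f w)))\<^sup>2"
    by (rule half_plane_Schwarz_Pick) (use pos g_in Re_pos v w in auto)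
  then have SP: "Re (f v) * Re (f w) * (norm (\<sigma> v + cnj (\<sigma> w)))\<^sup>2
     \<le> Re (\<sigma> v) * Re (\<sigma> w) * (norm (f v + cnj (f w)))\<^sup>2"
    using v w by (simp add: gf)
  let ?A = "norm (\<sigma> v)" and ?B = "norm (\<sigma> w)"
  have "sqrt (16 * norm (v - q)) \<le> sqrt (norm (w - q))" using far by simp
  then have AB: "4 * ?A \<le> ?B" by (simp add: n\<sigma> real_sqrt_mult)
  have B: "0 < ?B" using pos[OF w] by auto
  have "?B - ?A \<le> norm (\<sigma> v + cnj (\<sigma> w))"
    using norm_diff_ineq[of "cnj (\<sigma> w)" "\<sigma> v"] by (simp add: add.commute)
  then have "?B / 2 \<le> norm (\<sigma> v + cnj (\<sigma> w))" using AB B by linarith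
  then have "(?B / 2)\<^sup>2 \<le> (norm (\<sigma> v + cnj (\<sigma> w)))\<^sup>2" using B by (intro power_mono) auto
  then have "Re (f v) * Re (f w) * (?B / 2)\<^sup>2 \<le> Re (f v) * Re (f w) * (norm (\<sigma> v + cnj (\<sigma> w)))\<^sup>2"
    using Re_pos[OF v] Re_pos[OF w] by (intro mult_left_mono) auto
  also note SP
  also have "Re (\<sigma> v) * Re (\<sigma> w) * (norm (f v + cnj (f w)))\<^sup>2 \<le> ?A * ?B * (norm (f v + cnj (f w)))\<^sup>2"
    using pos[OF v] pos[OF w] by (intro mult_right_mono mult_mono complex_Re_le_cmod) auto
  finally have "?B * (Re (f v) * Re (f w) * ?B) \<le> ?B * (4 * ?A * (norm (f v + cnj (f w)))\<^sup>2)"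
    by (simp add: power2_eq_square mult_ac)
  then show ?thesis using B by (simp only: mult_le_cancel_left_pos n\<sigma>)
qed

end

section \<open>Domains that are wide on both sides\<close>

context starlike_half_plane_map
begin

text \<open>The contest is between the logarithmic growth of \<open>Im f\<close> in units of \<open>Re f\<close> and the power of \<open>L\<close>
  that \<open>slit_comparison\<close> provides; for large \<open>L\<close> the power wins and forces
  \<open>Re f\<close> to double.\<close>

theorem nontangential_if_wide_on_both_sides:
  assumes R: "0 < R" and k: "0 < \<kappa>"
    and wide: "\<And>t. R \<le> t \<Longrightarrow> ball (Complex 0 t) (\<kappa> * t) \<subseteq> \<Omega>"
    and q: "q \<notin> \<Omega>"
  shows "\<exists>K. \<forall>\<^sub>F t in at_top. \<bar>Im (f (Complex 0 t))\<bar> \<le> K * Re (f (Complex 0 t))"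
proof -
  define x where "x t = Re (f (Complex 0 t))" for t
  define y where "y t = Im (f (Complex 0 t))" for t
  define C where "C = 2 / \<kappa>"
  have C: "0 < C" using k by (simp add: C_def)
  have axis: "Complex 0 t \<in> \<Omega>" if "R \<le> t" for t
    using wide[OF that] that R k by (auto simp: subset_iff)
  have xpos: "0 < x t" if "R \<le> t" for t using Re_pos[OF axis[OF that]] by (simp add: x_def)
  have xmono: "x s \<le> x t" if "R \<le> s" "s \<le> t" for s t
    unfolding x_def by (rule Re_mono'[OF axis]) (use that in auto)
  have ygrow: "\<bar>y t - y s\<bar> \<le> C * x t * ln (t / s)" if st: "R \<le> s" "s \<le> t" for s t
  proof (rule log_growth_bound)
    fix r assume r: "s \<le> r" "r \<le> t"
    have Rr: "R \<le> r" using r st by simp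
    show "(y has_real_derivative Im (\<i> * deriv f (Complex 0 r))) (at r)"
      unfolding y_def
      by (rule has_real_derivative_along(2)[OF f_deriv[OF axis[OF Rr]] vertical_line_deriv])
    have "\<kappa> * r * norm (deriv f (Complex 0 r)) \<le> 2 * x r"
      unfolding x_def by (rule deriv_bound[OF wide[OF Rr]]) (use k Rr R in simp)
    also have "\<dots> \<le> 2 * x t" using xmono[OF Rr r(2)] by simp
    finally have "norm (deriv f (Complex 0 r)) \<le> C * x t / r"
      using k Rr R by (simp add: C_def field_simps)
    then show "\<bar>Im (\<i> * deriv f (Complex 0 r))\<bar> \<le> C * x t / r"
      using abs_Im_le_cmod[of "\<i> * deriv f (Complex 0 r)"] by (simp add: norm_mult)
  qed (use st R in auto)
  have "((\<lambda>L::real. (16 + 4 * C\<^sup>2 * (ln L)\<^sup>2) / sqrt ((L - 1) / 2)) \<longlongrightarrow> 0) at_top"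
    using C by real_asymp
  then have "\<forall>\<^sub>F L in at_top. (16 + 4 * C\<^sup>2 * (ln L)\<^sup>2) / sqrt ((L - 1) / 2) < 1/2"
    by (rule order_tendstoD) simp
  then have "\<forall>\<^sub>F L in at_top. (16 + 4 * C\<^sup>2 * (ln L)\<^sup>2) / sqrt ((L - 1) / 2) < 1/2 \<and> 33 \<le> L"
    using eventually_ge_at_top by (rule eventually_conj)
  then obtain L :: real where
    Lsmall: "(16 + 4 * C\<^sup>2 * (ln L)\<^sup>2) / sqrt ((L - 1) / 2) < 1/2" and L: "33 \<le> L"
    by (auto simp: eventually_at_top_linorder)
  \<comment> \<open>N bounds four times the squared norm in the slit comparison, in units of the square of Re f.\<close>
  define N where "N = 16 + 4 * C\<^sup>2 * (ln L)\<^sup>2"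
  define T where "T = max R (norm q)"
  have RT: "R \<le> T" and T: "0 < T" using R by (auto simp: T_def)
  have double: "2 * x s \<le> x (L * s)" if s: "T \<le> s" for s
  proof -
    have Rs: "R \<le> s" and qs: "norm q \<le> s" and s0: "0 < s" using s R by (auto simp: T_def)
    have sLs: "s \<le> L * s" using L s0 by simp
    have RLs: "R \<le> L * s" using Rs sLs by simp
    have nrm: "norm (Complex 0 r) = \<bar>r\<bar>" for r by (simp add: cmod_def)
    have up: "norm (Complex 0 s - q) \<le> 2 * s"
      using norm_triangle_ineq4[of "Complex 0 s" q] qs s0 by (simp add: nrm)
    have lo: "(L - 1) * s \<le> norm (Complex 0 (L * s) - q)"
      using norm_triangle_ineq2[of "Complex 0 (L * s)" q] qs s0 L by (simp add: nrm algebra_simps)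
    let ?n = "(norm (f (Complex 0 s) + cnj (f (Complex 0 (L * s)))))\<^sup>2"
    have "32 * s \<le> (L - 1) * s" using L s0 by simp
    then have "x s * x (L * s) * sqrt (norm (Complex 0 (L * s) - q)) \<le> 4 * sqrt (norm (Complex 0 s - q)) * ?n"
      unfolding x_def by (intro slit_comparison[OF q axis[OF Rs] axis[OF RLs]]) (use up lo in linarith)
    moreover have "x s * x (L * s) * sqrt ((L - 1) * s) \<le> x s * x (L * s) * sqrt (norm (Complex 0 (L * s) - q))"
      using lo xpos[OF Rs] xpos[OF RLs] by (intro mult_left_mono) auto
    moreover have "4 * sqrt (norm (Complex 0 s - q)) * ?n \<le> 4 * sqrt (2 * s) * ?n"
      using up by (intro mult_right_mono) auto
    ultimately have "x s * x (L * s) * sqrt ((L - 1) * s) \<le> 4 * sqrt (2 * s) * ?n" by linarith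
    moreover have "sqrt ((L - 1) * s) = sqrt ((L - 1) / 2) * sqrt (2 * s)"
      by (simp flip: real_sqrt_mult)
    ultimately have "sqrt (2 * s) * (x s * x (L * s) * sqrt ((L - 1) / 2)) \<le> sqrt (2 * s) * (4 * ?n)"
      by (simp add: mult_ac)
    then have "x s * x (L * s) * sqrt ((L - 1) / 2) \<le> 4 * ?n"
      using s0 by (simp add: mult_le_cancel_left_pos)
    also have "4 * ?n \<le> N * (x (L * s))\<^sup>2"
    proof -
      have "(x s + x (L * s))\<^sup>2 \<le> (2 * x (L * s))\<^sup>2"
        using xmono[OF Rs sLs] xpos[OF Rs] by (intro power_mono) auto
      moreover have "(y s - y (L * s))\<^sup>2 \<le> (C * x (L * s) * ln L)\<^sup>2"
      proof -
        have "\<bar>y s - y (L * s)\<bar> \<le> C * x (L * s) * ln L"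
          using ygrow[OF Rs sLs] s0 by (simp add: abs_minus_commute)
        then show ?thesis by (metis abs_ge_zero power2_abs power_mono)
      qed
      ultimately have "?n \<le> (2 * x (L * s))\<^sup>2 + (C * x (L * s) * ln L)\<^sup>2"
        by (simp add: norm_add_cnj_sq x_def y_def)
      then show ?thesis by (simp add: N_def power_mult_distrib algebra_simps)
    qed
    finally have "x (L * s) * (x s * sqrt ((L - 1) / 2)) \<le> x (L * s) * (N * x (L * s))"
      by (simp add: power2_eq_square mult_ac)
    then have "x s * sqrt ((L - 1) / 2) \<le> N * x (L * s)"
      using xpos[OF RLs] by (simp add: mult_le_cancel_left_pos)
    moreover have "2 * N \<le> sqrt ((L - 1) / 2)"
      using Lsmall L by (simp add: N_def divide_simps)
    moreover have "0 < N" by (simp add: N_def add_pos_nonneg)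
    ultimately have "x s * (2 * N) \<le> N * x (L * s)"
      using xpos[OF Rs] by (meson less_imp_le mult_left_mono order_trans)
    then show ?thesis using \<open>0 < N\<close> by (simp add: mult.commute mult.left_commute)
  qed
  define D where "D = C * ln L"
  have D: "0 < D" using C L by (simp add: D_def)
  have step: "\<bar>y t\<bar> \<le> \<bar>y s\<bar> + D * x t" if "T \<le> s" "s \<le> t" "t \<le> L * s" for s t
  proof -
    have s0: "0 < s" using that T by simp
    have "\<bar>y t - y s\<bar> \<le> C * x t * ln (t / s)" using ygrow that RT by simp
    also have "\<dots> \<le> C * x t * ln L"
      using that s0 C xpos[of t] RT L by (intro mult_left_mono ln_mono) (auto simp: field_simps)
    finally show ?thesis by (simp add: D_def mult_ac)
  qed
  \<comment> \<open>The increments of y sum to a geometric series that is dominated by its last term.\<close>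
  have iter: "\<bar>y t\<bar> - 2 * D * x t \<le> \<bar>y T\<bar>" if "T \<le> t" "t \<le> L ^ n * T" for n t
    using that
  proof (induction n arbitrary: t)
    case 0
    then have "t = T" by simp
    then show ?case using D xpos[OF RT] by simp
  next
    case (Suc n)
    show ?case
    proof (cases "t \<le> L * T")
      case True
      have "0 \<le> D * x t" using D xpos[of t] Suc.prems RT by simp
      then show ?thesis using step[of T t] True Suc.prems by simp
    next
      case False
      define s where "s = t / L"
      have s: "T \<le> s" "s \<le> L ^ n * T" "L * s = t" using False Suc.prems L by (auto simp: s_def field_simps)
      have "1 * s \<le> L * s" using s(1) T L by (intro mult_right_mono) auto
      then have "s \<le> t" using s(3) by simp
      have "\<bar>y t\<bar> \<le> \<bar>y s\<bar> + D * x t" using step[of s t] s \<open>s \<le> t\<close> by simp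
      moreover have "\<bar>y s\<bar> - 2 * D * x s \<le> \<bar>y T\<bar>" using Suc.IH s by simp
      moreover have "D * (2 * x s) \<le> D * x t" using double[OF s(1)] s(3) D by simp
      ultimately show ?thesis by (simp add: algebra_simps)
    qed
  qed
  have "\<bar>y t\<bar> \<le> (2 * D + \<bar>y T\<bar> / x T) * x t" if t: "T \<le> t" for t
  proof -
    obtain n where "t / T < L ^ n" using real_arch_pow[of L "t / T"] L by auto
    then have "\<bar>y t\<bar> - 2 * D * x t \<le> \<bar>y T\<bar>" by (intro iter[OF t, of n]) (use T in \<open>simp add: field_simps\<close>)
    moreover have "\<bar>y T\<bar> \<le> \<bar>y T\<bar> / x T * x t"
      using xmono[OF RT t] xpos[OF RT] by (simp add: field_simps mult_right_mono)
    ultimately show ?thesis by (simp add: algebra_simps)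
  qed
  then show ?thesis unfolding x_def y_def eventually_at_top_linorder by blast
qed

end

section \<open>Domains that are wide on the left and narrow on the right\<close>

context starlike_half_plane_map
begin

text \<open>Simple connectedness yields a primitive of \<open>f\<close>, and a primitive makes horizontal averages of \<open>Im f\<close> easy
  to differentiate.\<close>

lemma simply_connected_domain: "simply_connected \<Omega>"
proof -
  have "\<Omega> homeomorphic {z. 0 < Re z}"
    unfolding homeomorphic_minimal
    using Re_pos g_in gf fg holomorphic_on_imp_continuous_on[OF holf] holomorphic_on_imp_continuous_on[OF holg]
    by (intro exI[of _ f] exI[of _ g]) auto
  moreover have "convex {z. 0 < Re z}" by (rule convex_halfspace_Re_gt)
  ultimately show ?thesis
    using homeomorphic_simply_connected_eq convex_imp_simply_connected by blast
qed

lemma primitive_exists: "\<exists>F. \<forall>w\<in>\<Omega>. (F has_field_derivative f w) (at w)"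
  using simply_connected_eq_global_primitive[OF open_domain] simply_connected_domain holf by blast

end

text \<open>\<open>Complex (- u) t\<close> is the point at height \<open>t\<close> and at distance \<open>u\<close> to the left of the axis. The
  factor \<open>8\<close> leaves room to put disks of radius \<open>\<eta> t\<close> inside the wide region.\<close>

locale left_wide_map = starlike_half_plane_map +
  fixes \<eta> R :: real
  assumes R: "0 < R" and eta: "0 < \<eta>" "\<eta> \<le> 1/8"
    and wide: "R \<le> t \<Longrightarrow> 0 \<le> u \<Longrightarrow> u \<le> 8 * (\<eta> * t) \<Longrightarrow> Complex (- u) t \<in> \<Omega>"
begin

definition P :: "real \<Rightarrow> real \<Rightarrow> real" where "P t u = Re (f (Complex (- u) t))"
definition Q :: "real \<Rightarrow> real \<Rightarrow> real" where "Q t u = Im (f (Complex (- u) t))"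
text \<open>The reference value at height \<open>t\<close>, taken well inside the wide region.\<close>

definition X :: "real \<Rightarrow> real" where "X t = P t (\<eta> * t)"

lemma P_pos: "R \<le> t \<Longrightarrow> 0 \<le> u \<Longrightarrow> u \<le> 8 * (\<eta> * t) \<Longrightarrow> 0 < P t u"
  unfolding P_def by (intro Re_pos wide)

lemma eta_t: assumes "R \<le> t" shows "0 < \<eta> * t" "\<eta> * t \<le> t / 8"
  using assms R eta mult_right_mono[OF eta(2), of t] by auto

lemma X_pos: "R \<le> t \<Longrightarrow> 0 < X t"
  unfolding X_def using eta_t[of t] by (intro P_pos) auto

lemma ball_in:
  assumes t: "2 * R \<le> t" and u: "0 < u" "u \<le> 2 * (\<eta> * t)"
  shows "ball (Complex (- u) t) u \<subseteq> \<Omega>"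
proof
  fix z assume "z \<in> ball (Complex (- u) t) u"
  then have z: "norm (z - Complex (- u) t) < u" by (simp add: dist_norm norm_minus_commute)
  have re: "\<bar>Re z + u\<bar> < u" and im: "\<bar>Im z - t\<bar> < u"
    using abs_Re_le_cmod[of "z - Complex (- u) t"] abs_Im_le_cmod[of "z - Complex (- u) t"] z by auto
  have im2: "t / 2 \<le> Im z" using im u eta_t[of t] t R by linarith
  then have "\<eta> * (t / 2) \<le> \<eta> * Im z" using eta by (intro mult_left_mono) auto
  then have "Complex (- (- Re z)) (Im z) \<in> \<Omega>"
    using re im2 u t R by (intro wide) auto
  then show "z \<in> \<Omega>" by simp
qed

lemma deriv_bound_left:
  assumes "2 * R \<le> t" "0 < u" "u \<le> 2 * (\<eta> * t)"
  shows "norm (deriv f (Complex (- u) t)) \<le> 2 * P t u / u"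
  using deriv_bound[OF ball_in[OF assms] assms(2)] assms(2) by (simp add: P_def field_simps)

text \<open>The disk of radius \<open>\<eta> t\<close> about the reference point at height \<open>t\<close> touches the axis and lies in the domain.\<close>

lemma Harnack_X:
  assumes t: "2 * R \<le> t" and q: "(u - \<eta> * t)\<^sup>2 + (s - t)\<^sup>2 \<le> q * (\<eta> * t)\<^sup>2" "q < 1"
  shows "(1 - q) * P s u \<le> 4 * X t" "(1 - q) * X t \<le> 4 * P s u"
proof -
  have r: "0 < \<eta> * t" using eta_t[of t] t R by simp
  have b: "ball (Complex (- (\<eta> * t)) t) (\<eta> * t) \<subseteq> \<Omega>" using r eta_t[of t] t R by (intro ball_in) auto
  have n: "(norm (Complex (- u) s - Complex (- (\<eta> * t)) t))\<^sup>2 \<le> q * (\<eta> * t)\<^sup>2"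
    using q(1) unfolding norm_Complex_diff_sq by (simp add: power2_commute)
  show "(1 - q) * P s u \<le> 4 * X t" "(1 - q) * X t \<le> 4 * P s u"
    using Harnack[OF b r n q(2)] by (auto simp: P_def X_def)
qed

text \<open>A large value of \<open>Re f\<close> near the axis propagates upwards by monotonicity, hence fills a vertical
  segment, and by \<open>triangle_lower_bound\<close> it is then felt inside the domain. Therefore
  \<open>Re f\<close> cannot have a peak near the axis.\<close>

lemma Carleson:
  assumes t: "R \<le> t" and u: "0 \<le> u" and s: "0 < s" "u + s \<le> 8 * (\<eta> * t)"
  shows "P t u \<le> 4 * P (t + s) (u + s / 2)"
proof -
  define D where "D = {w. - Re w \<ge> u \<and> \<bar>Im w - (t + s)\<bar> \<le> s - (- Re w - u)}"
  have D: "w \<in> \<Omega>" "t \<le> Im w" if "w \<in> D" for w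
  proof -
    show *: "t \<le> Im w" using that by (auto simp: D_def)
    have "\<eta> * t \<le> \<eta> * Im w" using * eta by (intro mult_left_mono) auto
    then have "Complex (- (- Re w)) (Im w) \<in> \<Omega>"
      using * that u s t by (intro wide) (auto simp: D_def)
    then show "w \<in> \<Omega>" by simp
  qed
  have "P t u / 4 \<le> Re (f (Complex (- u - s / 2) (t + s)))"
  proof (rule triangle_lower_bound[where F = f and t = t and u = u and s = s, folded D_def])
    show "f holomorphic_on D" using holf by (rule holomorphic_on_subset) (use D in auto)
    show "0 \<le> Re (f w)" if "w \<in> D" for w using Re_pos[OF D(1)[OF that]] by simp
    show "P t u \<le> Re (f w)" if "w \<in> D" "- Re w = u" for w
    proof -
      have "Re (f (Complex (- u) t)) \<le> Re (f (Complex (- u) (Im w)))"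
        using D(2)[OF that(1)] t u s by (intro Re_mono' wide) auto
      moreover have "Complex (- u) (Im w) = w" using that(2) by (simp add: complex_eq_iff)
      ultimately show ?thesis by (simp add: P_def)
    qed
    show "0 \<le> P t u" using P_pos[of t u] t u s by simp
  qed (rule s)
  then show ?thesis by (simp add: P_def)
qed

text \<open>With \<open>s = \<eta> t / 2\<close> the point reached by \<open>Carleson\<close> is within the reach of Harnack's
  inequality from the reference point.\<close>

lemma P_le_X:
  assumes t: "2 * R \<le> t" and u: "0 \<le> u" "u \<le> \<eta> * t"
  shows "P t u \<le> 86 * X t"
proof -
  define s where "s = \<eta> * t / 2"
  have tR: "R \<le> t" using t R by simp
  have r: "0 < \<eta> * t" using eta_t[OF tR] by simp
  have "P t u \<le> 4 * P (t + s) (u + s / 2)"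
    using tR u r eta by (intro Carleson) (auto simp: s_def)
  moreover have "(1 - 13/16) * P (t + s) (u + s / 2) \<le> 4 * X t"
  proof (rule Harnack_X(1)[OF t])
    have "\<bar>u + s / 2 - \<eta> * t\<bar> \<le> 3/4 * (\<eta> * t)" using u r unfolding s_def by linarith
    then have "(u + s / 2 - \<eta> * t)\<^sup>2 \<le> (3/4 * (\<eta> * t))\<^sup>2" by (metis abs_ge_zero power2_abs power_mono)
    moreover have "(t + s - t)\<^sup>2 = 1/4 * (\<eta> * t)\<^sup>2" by (simp add: s_def power2_eq_square)
    ultimately show "(u + s / 2 - \<eta> * t)\<^sup>2 + (t + s - t)\<^sup>2 \<le> 13/16 * (\<eta> * t)\<^sup>2"
      by (simp add: power_mult_distrib power2_eq_square[of "3::real"] power_divide)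
  qed simp
  then have "3 * P (t + s) (u + s / 2) \<le> 64 * X t" by simp
  ultimately show ?thesis using X_pos[OF tR] by linarith
qed

lemma Q_deriv:
  assumes "Complex (- v) t \<in> \<Omega>"
  shows "(Q t has_real_derivative - Im (deriv f (Complex (- v) t))) (at v)"
  using has_real_derivative_along(2)[OF f_deriv[OF assms] horizontal_line_deriv]
  by (simp add: Q_def[abs_def])

lemma Q_mono:
  assumes t: "R \<le> t" and u: "0 \<le> u" "u \<le> v" "v \<le> 8 * (\<eta> * t)"
  shows "Q t u \<le> Q t v"
proof (rule DERIV_nonneg_imp_nondecreasing[OF u(2)])
  fix r assume "u \<le> r" "r \<le> v"
  then have "Complex (- r) t \<in> \<Omega>" using t u by (intro wide) auto
  then show "\<exists>d. (Q t has_real_derivative d) (at r) \<and> 0 \<le> d"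
    using Q_deriv Im_deriv_nonpos by fastforce
qed

text \<open>At distance \<open>r\<close> from the axis the derivative of \<open>f\<close> is at most \<open>2 P t r / r\<close>, and
  \<open>172 = 2 * 86\<close> by \<open>P_le_X\<close>.\<close>

lemma Q_log_growth:
  assumes t: "2 * R \<le> t" and u: "0 < u" "u \<le> \<eta> * t"
  shows "\<bar>Q t (\<eta> * t) - Q t u\<bar> \<le> 172 * X t * ln (\<eta> * t / u)"
proof (rule log_growth_bound[OF u])
  fix r assume r: "u \<le> r" "r \<le> \<eta> * t"
  have tR: "R \<le> t" using t R by simp
  show "(Q t has_real_derivative - Im (deriv f (Complex (- r) t))) (at r)"
    using r u eta_t[OF tR] tR by (intro Q_deriv wide) auto
  have "norm (deriv f (Complex (- r) t)) \<le> 2 * P t r / r"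
    using r u t eta eta_t[OF tR] by (intro deriv_bound_left) auto
  also have "\<dots> \<le> 172 * X t / r"
    using P_le_X[OF t, of r] r u by (intro divide_right_mono) auto
  finally show "\<bar>- Im (deriv f (Complex (- r) t))\<bar> \<le> 172 * X t / r"
    using abs_Im_le_cmod[of "deriv f (Complex (- r) t)"] by simp
qed

text \<open>In units of \<open>X t\<close>, the bound produced by \<open>slit_comparison\<close> for a point at relative distance \<open>\<mu>\<close>
  from the axis: the square root comes from the slit plane, \<open>7569 = 87^2\<close> from \<open>P_le_X\<close>
  and \<open>29584 = 172^2\<close> from \<open>Q_log_growth\<close>.\<close>

definition decay_rate :: "real \<Rightarrow> real" where
  "decay_rate \<mu> = 8 * sqrt (\<mu> / \<eta>) * (7569 + 29584 * (ln (\<eta> / \<mu>))\<^sup>2)"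

lemma decay_rate_tendsto: "(decay_rate \<longlongrightarrow> 0) (at_right 0)"
  unfolding decay_rate_def[abs_def] using eta(1) by real_asymp

text \<open>A point close to the omitted \<open>w\<close> is hyperbolically far from the reference point. The large distance
  cannot come from a large real part, by \<open>P_le_X\<close>, nor from the difference of the imaginary
  parts, which is only logarithmic; so the real part must be small.\<close>

lemma P_decay:
  assumes t: "2 * R \<le> t" and m: "0 < \<mu>" "64 * \<mu> \<le> \<eta>"
    and w: "w \<notin> \<Omega>" "norm (w - Complex 0 t) \<le> \<mu> * t"
  shows "P t (\<mu> * t) \<le> decay_rate \<mu> * X t"
proof -
  let ?v = "Complex (- (\<mu> * t)) t" and ?b = "Complex (- (\<eta> * t)) t"
  let ?n = "(norm (f ?v + cnj (f ?b)))\<^sup>2" and ?p = "P t (\<mu> * t)"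
  have tR: "R \<le> t" and t0: "0 < t" using t R by auto
  have mt: "0 < \<mu> * t" "64 * (\<mu> * t) \<le> \<eta> * t"
    using m t0 mult_right_mono[OF m(2), of t] by (auto simp: mult.assoc)
  have v: "?v \<in> \<Omega>" and b: "?b \<in> \<Omega>"
    by (intro wide tR; use mt eta_t(1)[OF tR] in linarith)+
  have pp: "0 < ?p" and Xp: "0 < X t" using Re_pos[OF v] X_pos[OF tR] by (auto simp: P_def)
  have nh: "norm (Complex (- a) t - Complex 0 t) = \<bar>a\<bar>" for a by (simp add: cmod_def)
  have vw: "norm (?v - w) \<le> 2 * (\<mu> * t)"
    using norm_triangle_ineq[of "?v - Complex 0 t" "Complex 0 t - w"] w(2) nh[of "\<mu> * t"] mt
    by (simp add: norm_minus_commute)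
  have bw: "\<eta> * t / 2 \<le> norm (?b - w)"
    using norm_triangle_ineq[of "?b - w" "w - Complex 0 t"] w(2) nh[of "\<eta> * t"] mt by simp
  have "?p * X t * sqrt (norm (?b - w)) \<le> 4 * sqrt (norm (?v - w)) * ?n"
    unfolding X_def P_def by (rule slit_comparison[OF w(1) v b]) (use vw bw mt in linarith)
  moreover have "?p * X t * sqrt (\<eta> * t / 2) \<le> ?p * X t * sqrt (norm (?b - w))"
    using bw pp Xp by (intro mult_left_mono) auto
  moreover have "4 * sqrt (norm (?v - w)) * ?n \<le> 4 * sqrt (2 * (\<mu> * t)) * ?n"
    using vw by (intro mult_right_mono) auto
  ultimately have "?p * X t * sqrt (\<eta> * t / 2) \<le> 4 * sqrt (2 * (\<mu> * t)) * ?n" by linarith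
  moreover have "sqrt (2 * (\<mu> * t)) = 2 * sqrt (\<mu> / \<eta>) * sqrt (\<eta> * t / 2)"
  proof -
    have "2 * (\<mu> * t) = 4 * (\<mu> / \<eta>) * (\<eta> * t / 2)" using eta by simp
    then show ?thesis by (simp only: real_sqrt_mult) simp
  qed
  ultimately have "sqrt (\<eta> * t / 2) * (?p * X t) \<le> sqrt (\<eta> * t / 2) * (8 * sqrt (\<mu> / \<eta>) * ?n)"
    by (simp add: mult_ac)
  then have "?p * X t \<le> 8 * sqrt (\<mu> / \<eta>) * ?n"
    using eta_t(1)[OF tR] by (subst (asm) mult_le_cancel_left_pos) auto
  also have "?n \<le> (7569 + 29584 * (ln (\<eta> / \<mu>))\<^sup>2) * (X t)\<^sup>2"
  proof -
    have "(?p + X t)\<^sup>2 \<le> (87 * X t)\<^sup>2"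
      using P_le_X[OF t, of "\<mu> * t"] mt pp Xp by (intro power_mono) auto
    moreover have "(Q t (\<mu> * t) - Q t (\<eta> * t))\<^sup>2 \<le> (172 * X t * ln (\<eta> / \<mu>))\<^sup>2"
    proof -
      have "\<bar>Q t (\<mu> * t) - Q t (\<eta> * t)\<bar> \<le> 172 * X t * ln (\<eta> / \<mu>)"
        using Q_log_growth[OF t mt(1)] m t0 by (subst abs_minus_commute) simp
      then show ?thesis by (metis abs_ge_zero power2_abs power_mono)
    qed
    moreover have "?n = (?p + X t)\<^sup>2 + (Q t (\<mu> * t) - Q t (\<eta> * t))\<^sup>2"
      by (simp add: norm_add_cnj_sq X_def P_def Q_def)
    ultimately show ?thesis by (simp add: power_mult_distrib algebra_simps)
  qed
  finally have "X t * ?p \<le> X t * (decay_rate \<mu> * X t)"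
    using m eta by (simp add: decay_rate_def power2_eq_square mult_ac mult_left_mono)
  then show ?thesis using Xp by simp
qed

text \<open>\<open>P_decay\<close> applies only to points that are not closer to the axis than the omitted point; \<open>Carleson\<close>
  reduces the remaining points to these.\<close>

lemma P_small_near_axis:
  assumes narrow: "\<And>\<epsilon>. 0 < \<epsilon> \<Longrightarrow> \<forall>\<^sub>F t in at_top. \<exists>w. w \<notin> \<Omega> \<and> norm (w - Complex 0 t) \<le> \<epsilon> * t"
    and e: "0 < \<epsilon>"
  shows "\<exists>\<delta>>0. \<delta> \<le> \<eta> \<and> (\<forall>\<^sub>F t in at_top. \<forall>u. 0 \<le> u \<and> u \<le> \<delta> * t \<longrightarrow> P t u \<le> \<epsilon> * X t)"
proof -
  have "\<forall>\<^sub>F \<mu> in at_right 0. decay_rate \<mu> < \<epsilon> / 32"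
    using decay_rate_tendsto by (rule order_tendstoD) (use e in simp)
  then obtain m where m: "0 < m" "\<And>\<mu>. 0 < \<mu> \<Longrightarrow> \<mu> < m \<Longrightarrow> decay_rate \<mu> < \<epsilon> / 32"
    by (auto simp: eventually_at_right_field)
  define \<delta> where "\<delta> = min (m / 4) (\<eta> / 256)"
  have l: "0 < \<delta>" "4 * \<delta> \<le> m" "256 * \<delta> \<le> \<eta>" using m eta by (auto simp: \<delta>_def)
  obtain T where T: "\<And>t. T \<le> t \<Longrightarrow> \<exists>w. w \<notin> \<Omega> \<and> norm (w - Complex 0 t) \<le> \<delta> / 2 * t"
    using narrow[of "\<delta> / 2"] l by (auto simp: eventually_at_top_linorder)
  have "P t u \<le> \<epsilon> * X t" if t: "max T (2 * R) \<le> t" and u: "0 \<le> u" "u \<le> \<delta> * t" for t u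
  proof -
    define s where "s = 2 * (\<delta> * t)"
    define t' where "t' = t + s"
    define \<mu> where "\<mu> = (u + s / 2) / t'"
    have t2: "2 * R \<le> t" and tR: "R \<le> t" and t0: "0 < t" using t R by auto
    have lt: "0 < \<delta> * t" "256 * (\<delta> * t) \<le> \<eta> * t"
      using l t0 mult_right_mono[OF l(3), of t] by (auto simp: mult.assoc)
    have s: "0 < s" using lt by (simp add: s_def)
    have mt': "\<mu> * t' = u + s / 2" using t0 s by (simp add: \<mu>_def t'_def)
    have t'0: "0 < t'" using t0 s by (simp add: t'_def)
    have "0 < \<mu> * t'" unfolding mt' using u s by simp
    moreover have "\<mu> * t' \<le> (2 * \<delta>) * t'"
    proof -
      have "0 < \<delta> * s" using l s by simp
      then show ?thesis unfolding mt' using u by (simp add: t'_def s_def algebra_simps)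
    qed
    ultimately have m0: "0 < \<mu>" "\<mu> \<le> 2 * \<delta>"
      using t'0 by (simp_all only: zero_less_mult_pos2 mult_le_cancel_right_pos)
    have "P t u \<le> 4 * P t' (u + s / 2)"
      unfolding t'_def by (intro Carleson tR s u; use s_def lt u in linarith)
    also note mt'[symmetric]
    also have "P t' (\<mu> * t') \<le> decay_rate \<mu> * X t'"
    proof -
      obtain w where w: "w \<notin> \<Omega>" "norm (w - Complex 0 t') \<le> \<delta> / 2 * t'"
        using T[of t'] t s by (auto simp: t'_def)
      have "s \<le> t" using lt eta_t(2)[OF tR] t0 by (simp add: s_def)
      then have "\<delta> * s \<le> \<delta> * t" using l by simp
      then have "\<delta> / 2 * t' \<le> \<mu> * t'"
        using u(1) mt' by (simp add: t'_def s_def algebra_simps)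
      then show ?thesis
        using w t2 s l m0 by (intro P_decay[of t' \<mu> w]) (auto simp: t'_def)
    qed
    also have "decay_rate \<mu> * X t' \<le> \<epsilon> / 32 * X t'"
    proof (rule mult_right_mono)
      show "decay_rate \<mu> \<le> \<epsilon> / 32" using m(2)[of \<mu>] l m0 by simp
      show "0 \<le> X t'" using X_pos[of t'] tR s by (simp add: t'_def)
    qed
    also have "X t' \<le> 8 * X t"
    proof -
      have "(1 - 1/2) * P t' (\<eta> * t') \<le> 4 * X t"
      proof (rule Harnack_X(1)[OF t2])
        have "(\<eta> * t' - \<eta> * t)\<^sup>2 = \<eta>\<^sup>2 * s\<^sup>2" by (simp add: t'_def power2_eq_square algebra_simps)
        also have "\<dots> \<le> 1 * s\<^sup>2" using eta by (intro mult_right_mono) (auto simp: power_le_one)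
        finally have "(\<eta> * t' - \<eta> * t)\<^sup>2 + (t' - t)\<^sup>2 \<le> 2 * s\<^sup>2" by (simp add: t'_def)
        also have "\<dots> \<le> 2 * (\<eta> * t / 2)\<^sup>2"
          using lt s by (intro mult_left_mono power_mono) (auto simp: s_def)
        finally show "(\<eta> * t' - \<eta> * t)\<^sup>2 + (t' - t)\<^sup>2 \<le> 1/2 * (\<eta> * t)\<^sup>2"
          by (simp add: power_divide)
      qed simp
      then show ?thesis by (simp add: X_def)
    qed
    finally show ?thesis using e by (simp add: mult_ac)
  qed
  then show ?thesis using l eta
    by (intro exI[of _ \<delta>]) (auto simp: eventually_at_top_linorder intro!: exI[of _ "max T (2 * R)"])
qed

text \<open>Inside the disk that touches the axis, a positive harmonic function decays at most linearly towards
  the point of contact.\<close>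

lemma P_lower:
  assumes t: "2 * R \<le> t" and l: "0 < \<delta>" "\<delta> \<le> \<eta>"
  shows "\<delta> / (4 * \<eta>) * X t \<le> P t (\<delta> * t)"
proof -
  define q where "q = (1 - \<delta> / \<eta>)\<^sup>2"
  have le: "0 < \<delta> / \<eta>" "\<delta> / \<eta> \<le> 1" using l eta by auto
  have "q \<le> 1 - \<delta> / \<eta>"
    unfolding q_def power2_eq_square using le by (intro mult_left_le) auto
  then have q: "\<delta> / \<eta> \<le> 1 - q" by simp
  have "(1 - q) * X t \<le> 4 * P t (\<delta> * t)"
  proof (rule Harnack_X(2)[OF t])
    show "(\<delta> * t - \<eta> * t)\<^sup>2 + (t - t)\<^sup>2 \<le> q * (\<eta> * t)\<^sup>2"
      using eta unfolding q_def power_mult_distrib[symmetric]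
      by (simp add: algebra_simps power2_commute)
  qed (use q le in simp)
  moreover have "\<delta> / \<eta> * X t \<le> (1 - q) * X t"
    using q X_pos[of t] t R by (intro mult_right_mono) auto
  ultimately show ?thesis by (simp add: field_simps)
qed

text \<open>\<open>G t\<close> is the average of \<open>Im f\<close> over the horizontal segment of length \<open>\<delta> t\<close> to the left of
  \<open>\<i> t\<close>. It bounds \<open>Im f\<close> on the axis because \<open>Im f\<close> increases to the left. By the
  Cauchy-Riemann equations, its derivative is the difference of \<open>Re f\<close> at the two ends of the segment divided by
  \<open>\<delta> t\<close>, plus an error caused by the growing length. The first part is at most a negative
  multiple of \<open>X t / t\<close>, since \<open>Re f\<close> is \<open>o(X)\<close> on the axis but comparable to
  \<open>\<delta> X\<close> at the other end. The error is at most half of this when \<open>\<delta>\<close> is small enough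
  for \<open>Re f\<close> to be small on the whole segment.\<close>

theorem tangential_if_narrow_on_the_right:
  assumes narrow: "\<And>\<epsilon>. 0 < \<epsilon> \<Longrightarrow> \<forall>\<^sub>F t in at_top. \<exists>w. w \<notin> \<Omega> \<and> norm (w - Complex 0 t) \<le> \<epsilon> * t"
  shows "\<forall>\<^sub>F t in at_top. Im (f (Complex 0 t)) \<le> - M * Re (f (Complex 0 t))"
proof -
  obtain F where F: "\<And>w. w \<in> \<Omega> \<Longrightarrow> (F has_field_derivative f w) (at w)"
    using primitive_exists by blast
  obtain \<delta> T1 where l: "0 < \<delta>" "\<delta> \<le> \<eta>"
    and T1: "\<And>t u. T1 \<le> t \<Longrightarrow> 0 \<le> u \<Longrightarrow> u \<le> \<delta> * t \<Longrightarrow> P t u \<le> 1 / (32 * \<eta>) * X t"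
    using P_small_near_axis[OF narrow, of "1 / (32 * \<eta>)"] eta by (auto simp: eventually_at_top_linorder)
  have small0: "\<forall>\<^sub>F t in at_top. P t 0 \<le> \<epsilon> * X t" if e: "0 < \<epsilon>" for \<epsilon>
  proof -
    obtain \<delta>' where l': "0 < \<delta>'" and ev: "\<forall>\<^sub>F t in at_top. \<forall>u. 0 \<le> u \<and> u \<le> \<delta>' * t \<longrightarrow> P t u \<le> \<epsilon> * X t"
      using P_small_near_axis[OF narrow e] by blast
    show ?thesis
      using ev eventually_gt_at_top[of 0] by eventually_elim (use l' in auto)
  qed
  obtain T2 where T2: "\<And>t. T2 \<le> t \<Longrightarrow> P t 0 \<le> \<delta> / (8 * \<eta>) * X t"
    using small0[of "\<delta> / (8 * \<eta>)"] l eta by (auto simp: eventually_at_top_linorder)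
  define T where "T = Max {T1, T2, 2 * R}"
  have T: "T1 \<le> T" "T2 \<le> T" "2 * R \<le> T" by (auto simp: T_def)
  have T0: "0 < T" using T R by linarith
  define N where "N t v = Im (F (Complex 0 t)) - Im (F (Complex (- v) t))" for t v
  define G where "G t = N t (\<delta> * t) / (\<delta> * t)" for t
  have lt: "0 < \<delta> * t" "\<delta> * t \<le> \<eta> * t" if "T \<le> t" for t
    using that T0 l by (auto intro!: mult_right_mono)
  have mem: "Complex (- v) t \<in> \<Omega>" if "T \<le> t" "0 \<le> v" "v \<le> \<delta> * t" for t v
    by (intro wide; use that lt[of t] eta_t[of t] T R in linarith)
  have N0: "N t 0 = 0" for t by (simp add: N_def)
  have dNv: "(N t has_real_derivative Q t v) (at v)" if "T \<le> t" "0 \<le> v" "v \<le> \<delta> * t" for t v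
  proof -
    have "((\<lambda>v. Im (F (Complex (- v) t))) has_real_derivative Im (-1 * f (Complex (- v) t))) (at v)"
      by (rule has_real_derivative_along(2)[OF F[OF mem[OF that]] horizontal_line_deriv])
    from DERIV_diff[OF DERIV_const this] show ?thesis by (simp add: N_def[abs_def] Q_def)
  qed
  have y_le_G: "Q t 0 \<le> G t" if t: "T \<le> t" for t
  proof -
    have "N t 0 - 0 * Q t 0 \<le> N t (\<delta> * t) - (\<delta> * t) * Q t 0"
    proof (rule DERIV_nonneg_imp_nondecreasing[where f = "\<lambda>v. N t v - v * Q t 0"])
      fix v assume v: "0 \<le> v" "v \<le> \<delta> * t"
      have "((\<lambda>v. N t v - v * Q t 0) has_real_derivative Q t v - 1 * Q t 0) (at v)"
        by (intro DERIV_diff dNv t v) (auto intro!: derivative_eq_intros)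
      moreover have "Q t 0 \<le> Q t v"
        by (intro Q_mono; use v t lt[OF t] eta_t[of t] T R in linarith)
      ultimately show "\<exists>d. ((\<lambda>v. N t v - v * Q t 0) has_real_derivative d) (at v) \<and> 0 \<le> d" by force
    qed (use lt[OF t] in simp)
    then show ?thesis using lt(1)[OF t] by (simp add: N0 G_def pos_le_divide_eq mult.commute)
  qed
  \<comment> \<open>The error term: v |f'| is at most 2 Re f at distance v from the axis, hence small against X t.\<close>
  have Q_le_G: "Q t (\<delta> * t) - G t \<le> X t / (16 * \<eta>)" if t: "T \<le> t" for t
  proof -
    let ?c = "X t / (16 * \<eta>)"
    have c: "0 < ?c" using X_pos[of t] t T R eta by simp
    have "(\<delta> * t) * Q t (\<delta> * t) - N t (\<delta> * t) - ?c * (\<delta> * t) \<le> 0 * Q t 0 - N t 0 - ?c * 0"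
    proof (rule DERIV_nonpos_imp_nonincreasing[where f = "\<lambda>v. v * Q t v - N t v - ?c * v"])
      fix v assume v: "0 \<le> v" "v \<le> \<delta> * t"
      let ?d = "deriv f (Complex (- v) t)"
      have "((\<lambda>v. v * Q t v - N t v - ?c * v) has_real_derivative
              (1 * Q t v + (- Im ?d) * v) - Q t v - ?c * 1) (at v)"
        by (intro DERIV_diff DERIV_mult DERIV_cmult DERIV_ident dNv t v Q_deriv mem)
      moreover have "- Im ?d * v \<le> ?c"
      proof (cases "v = 0")
        case False
        then have v0: "0 < v" using v by simp
        have "norm ?d \<le> 2 * P t v / v"
          by (intro deriv_bound_left; use v0 v t T lt[OF t] in linarith)
        then have "norm ?d * v \<le> 2 * P t v" using v0 by (simp add: field_simps)
        moreover have "P t v \<le> 1 / (32 * \<eta>) * X t" using T1[of t v] t T v by simp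
        moreover have "- Im ?d * v \<le> norm ?d * v"
          using abs_Im_le_cmod[of ?d] v0 by (intro mult_right_mono) auto
        ultimately show ?thesis by simp
      qed (use c in simp)
      ultimately show "\<exists>d. ((\<lambda>v. v * Q t v - N t v - ?c * v) has_real_derivative d) (at v) \<and> d \<le> 0" by force
    qed (use lt[OF t] in simp)
    then have "(\<delta> * t) * (Q t (\<delta> * t) - G t) \<le> (\<delta> * t) * ?c"
      using lt(1)[OF t] l by (simp add: N0 G_def algebra_simps)
    then show ?thesis using lt(1)[OF t] by (simp only: mult_le_cancel_left_pos)
  qed
  have "\<exists>d. (G has_real_derivative d) (at t) \<and> d \<le> - X t / (16 * \<eta> * t)" if t: "T \<le> t" for t
  proof -
    have t0: "0 < t" using t T0 by simp
    have Xp: "0 < X t" using X_pos[of t] t T R by simp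
    have "((\<lambda>r. Im (F (Complex 0 r))) has_real_derivative Im (\<i> * f (Complex 0 t))) (at t)"
      using mem[OF t, of 0] lt[OF t] by (intro has_real_derivative_along(2)[OF F vertical_line_deriv]) auto
    moreover have "((\<lambda>r. Im (F (Complex (- (\<delta> * r)) r))) has_real_derivative
        Im (Complex (- \<delta>) 1 * f (Complex (- (\<delta> * t)) t))) (at t)"
      using mem[OF t, of "\<delta> * t"] lt[OF t]
      by (intro has_real_derivative_along(2)[OF F])
         (auto simp: has_vector_derivative_complex_iff intro!: derivative_eq_intros)
    ultimately have "((\<lambda>r. N r (\<delta> * r)) has_real_derivative
        Im (\<i> * f (Complex 0 t)) - Im (Complex (- \<delta>) 1 * f (Complex (- (\<delta> * t)) t))) (at t)"
      unfolding N_def by (rule DERIV_diff)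
    then have dN: "((\<lambda>r. N r (\<delta> * r)) has_real_derivative
        P t 0 - (P t (\<delta> * t) - \<delta> * Q t (\<delta> * t))) (at t)"
      by (simp add: P_def Q_def)
    let ?d = "(P t 0 - P t (\<delta> * t)) / (\<delta> * t) + (Q t (\<delta> * t) - G t) / t"
    have "(G has_real_derivative ?d) (at t)"
    proof -
      have "((\<lambda>r. N r (\<delta> * r) / (\<delta> * r)) has_real_derivative
          ((P t 0 - (P t (\<delta> * t) - \<delta> * Q t (\<delta> * t))) * (\<delta> * t) - N t (\<delta> * t) * \<delta>)
            / ((\<delta> * t) * (\<delta> * t))) (at t)"
        using l t0 by (intro DERIV_divide dN DERIV_cmult_Id) auto
      moreover have "((P t 0 - (P t (\<delta> * t) - \<delta> * Q t (\<delta> * t))) * (\<delta> * t) - N t (\<delta> * t) * \<delta>)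
            / ((\<delta> * t) * (\<delta> * t)) = ?d"
        using l t0 by (simp add: G_def field_simps)
      ultimately show ?thesis by (simp add: G_def[abs_def])
    qed
    moreover have "?d \<le> - X t / (16 * \<eta> * t)"
    proof -
      have "P t 0 - P t (\<delta> * t) \<le> - (\<delta> / (8 * \<eta>) * X t)"
        using T2[of t] P_lower[OF _ l, of t] t T by (simp add: field_simps)
      then have "(P t 0 - P t (\<delta> * t)) / (\<delta> * t) \<le> - (\<delta> / (8 * \<eta>) * X t) / (\<delta> * t)"
        using lt(1)[OF t] by (intro divide_right_mono) auto
      also have "\<dots> = - (X t / (8 * \<eta> * t))" using l by simp
      finally have "(P t 0 - P t (\<delta> * t)) / (\<delta> * t) \<le> - (X t / (8 * \<eta> * t))" .
      moreover have "(Q t (\<delta> * t) - G t) / t \<le> X t / (16 * \<eta>) / t"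
        using Q_le_G[OF t] t0 by (intro divide_right_mono) auto
      moreover have "- (X t / (8 * \<eta> * t)) + X t / (16 * \<eta>) / t = - X t / (16 * \<eta> * t)"
        using t0 eta(1) by (simp add: field_simps)
      ultimately show ?thesis by linarith
    qed
    ultimately show ?thesis by blast
  qed
  then obtain G' where dG: "\<And>t. T \<le> t \<Longrightarrow> (G has_real_derivative G' t) (at t) \<and> G' t \<le> - X t / (16 * \<eta> * t)"
    by metis
  \<comment> \<open>The monotonicity of G avoids a summation: only the last decrease, of size comparable to X t, is kept.\<close>
  have Gdec: "G t \<le> G s" if st: "T \<le> s" "s \<le> t" for s t
  proof (rule DERIV_nonpos_imp_nonincreasing[OF st(2)])
    fix r assume r: "s \<le> r" "r \<le> t"
    then have "T \<le> r" using st by simp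
    moreover have "- X r / (16 * \<eta> * r) \<le> 0"
      using X_pos[of r] \<open>T \<le> r\<close> T T0 R eta by (auto intro!: divide_nonneg_nonneg)
    ultimately show "\<exists>d. (G has_real_derivative d) (at r) \<and> d \<le> 0" using dG[of r] by (meson order_trans)
  qed
  \<comment> \<open>X changes at most by a bounded factor between s and t, so the decrease of G over this interval is comparable to X t.\<close>
  have key: "Q t 0 \<le> G T - X t / 256" if t: "2 * T \<le> t" for t
  proof -
    define s where "s = t - \<eta> * t / 2"
    have tT: "T \<le> t" and t0: "0 < t" and tR: "R \<le> t" and t2: "2 * R \<le> t" using t T T0 R by auto
    have s: "T \<le> s" "s < t" using eta_t[OF tR] t t0 s_def by linarith+
    obtain \<xi> where xi: "s < \<xi>" "\<xi> < t" "G t - G s = (t - s) * G' \<xi>"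
      using MVT2[OF s(2), of G G'] dG s(1) by (meson order_trans)
    have xi0: "0 < \<xi>" using xi s T0 by simp
    have Xxi: "X t \<le> 8 * X \<xi>"
    proof -
      have "(1 - 1/2) * X t \<le> 4 * P \<xi> (\<eta> * \<xi>)"
      proof (rule Harnack_X(2)[OF t2])
        have "(\<eta> * \<xi> - \<eta> * t)\<^sup>2 = \<eta>\<^sup>2 * (t - \<xi>)\<^sup>2" by (simp add: power2_eq_square algebra_simps)
        also have "\<dots> \<le> 1 * (t - \<xi>)\<^sup>2" using eta by (intro mult_right_mono) (auto simp: power_le_one)
        finally have "(\<eta> * \<xi> - \<eta> * t)\<^sup>2 + (\<xi> - t)\<^sup>2 \<le> 2 * (t - \<xi>)\<^sup>2" by (simp add: power2_commute)
        also have "\<dots> \<le> 2 * (\<eta> * t / 2)\<^sup>2"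
          using xi by (intro mult_left_mono power_mono) (auto simp: s_def)
        finally show "(\<eta> * \<xi> - \<eta> * t)\<^sup>2 + (\<xi> - t)\<^sup>2 \<le> 1/2 * (\<eta> * t)\<^sup>2"
          by (simp add: power_divide)
      qed simp
      then show ?thesis by (simp add: X_def)
    qed
    have "G' \<xi> \<le> - X \<xi> / (16 * \<eta> * \<xi>)" using dG[of \<xi>] xi s by simp
    also have "\<dots> \<le> - X \<xi> / (16 * \<eta> * t)"
      using xi xi0 X_pos[of \<xi>] s T R eta by (simp add: frac_le)
    finally have "(t - s) * G' \<xi> \<le> (t - s) * (- X \<xi> / (16 * \<eta> * t))"
      using s by (intro mult_left_mono) auto
    also have "\<dots> = - X \<xi> / 32" using t0 eta(1) by (simp add: s_def)
    finally have "G t \<le> G s - X \<xi> / 32" using xi(3) by linarith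
    then show ?thesis using y_le_G[OF tT] Gdec[of T s] s Xxi by linarith
  qed
  define x0 where "x0 = P T 0"
  have x0: "0 < x0" unfolding x0_def by (rule P_pos; use eta_t(1)[of T] T R in linarith)
  \<comment> \<open>With this \<open>\<epsilon>\<close>, one half of X t / 256 absorbs G T and the other half absorbs M times Re f.\<close>
  define c where "c = \<bar>G T\<bar> + 1"
  define m where "m = \<bar>M\<bar> + 1"
  define \<epsilon> where "\<epsilon> = min (1 / (512 * m)) (x0 / (512 * c))"
  have m: "0 < m" and c: "0 < c" by (auto simp: m_def c_def)
  have e: "0 < \<epsilon>" "\<epsilon> * (512 * m) \<le> 1" "\<epsilon> * (512 * c) \<le> x0"
  proof -
    show "0 < \<epsilon>" using m c x0 by (simp add: \<epsilon>_def)
    have "\<epsilon> \<le> 1 / (512 * m)" "\<epsilon> \<le> x0 / (512 * c)" by (auto simp: \<epsilon>_def)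
    then show "\<epsilon> * (512 * m) \<le> 1" "\<epsilon> * (512 * c) \<le> x0" using m c by (auto simp: pos_le_divide_eq)
  qed
  have "\<forall>\<^sub>F t in at_top. Q t 0 \<le> - M * P t 0"
    using small0[OF e(1)] eventually_ge_at_top[of "2 * T"]
  proof eventually_elim
    case (elim t)
    have t: "T \<le> t" "R \<le> t" using elim T T0 R by auto
    have "x0 \<le> P t 0"
      unfolding x0_def P_def by (intro Re_mono' wide; use t T R eta_t(1)[of T] in linarith)
    have "\<epsilon> * (512 * c) \<le> \<epsilon> * X t" using e(3) \<open>x0 \<le> P t 0\<close> elim by linarith
    then have "512 * c \<le> X t" using e(1) by simp
    moreover have "512 * m * P t 0 \<le> X t"
    proof -
      have "(512 * m) * P t 0 \<le> (512 * m) * (\<epsilon> * X t)" using elim m by (intro mult_left_mono) auto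
      also have "\<dots> = (\<epsilon> * (512 * m)) * X t" by simp
      also have "\<dots> \<le> 1 * X t" using e(2) X_pos[OF t(2)] by (intro mult_right_mono) auto
      finally show ?thesis by simp
    qed
    moreover have "M * P t 0 \<le> m * P t 0"
      using \<open>x0 \<le> P t 0\<close> x0 by (intro mult_right_mono) (auto simp: m_def)
    moreover have "G T \<le> c" by (simp add: c_def)
    ultimately show ?case using key[OF elim(2)] by simp
  qed
  then show ?thesis by (simp add: P_def Q_def)
qed

end

section \<open>Julia's lemma\<close>

text \<open>\<open>m n = Re (1 / b n)\<close> measures how close \<open>b n\<close> is to infinity within the half-plane. It tends to \<open>0\<close>, so it
  cannot increase at every step from some index on. At a step where it does not increase, the Schwarz-Pick
  inequality for \<open>a\<close> and \<open>b n\<close> gives the claim up to an error that vanishes in the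
  limit.\<close>

lemma half_plane_Julia:
  assumes hol: "\<Phi> holomorphic_on {z. 0 < Re z}"
    and pos: "\<And>z. 0 < Re z \<Longrightarrow> 0 < Re (\<Phi> z)"
    and b: "\<And>n. 0 < Re (b n)" and orbit: "\<And>n. \<Phi> (b n) = b (Suc n)"
    and lim: "(\<lambda>n. inverse (b n)) \<longlonglongrightarrow> 0"
    and a: "0 < Re a"
  shows "Re a \<le> Re (\<Phi> a)"
proof (rule ccontr)
  assume "\<not> Re a \<le> Re (\<Phi> a)"
  then have less: "Re (\<Phi> a) < Re a" by simp
  define m where "m n = Re (inverse (b n))" for n
  define lo where "lo n = Re a * (norm (1 + \<Phi> a * cnj (inverse (b (Suc n)))))\<^sup>2" for n
  define up where "up n = Re (\<Phi> a) * (norm (1 + a * cnj (inverse (b n))))\<^sup>2" for n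
  have b0: "b n \<noteq> 0" for n using b[of n] by auto
  have m: "m n = Re (b n) / (norm (b n))\<^sup>2" for n
    by (simp add: m_def Re_divide_of_real inverse_eq_divide complex_div_cnj[of 1 "b n"] flip: of_real_power)
  have mpos: "0 < m n" for n using b b0 by (simp add: m)
  have factor: "norm (c + cnj (b n)) = norm (1 + c * cnj (inverse (b n))) * norm (b n)" for c n
  proof -
    have "c + cnj (b n) = (1 + c * cnj (inverse (b n))) * cnj (b n)"
      using b0[of n] by (simp add: field_simps)
    then show ?thesis by (simp add: norm_mult)
  qed
  have step: "m n * lo n \<le> m (Suc n) * up n" for n
  proof -
    have "Re a * Re (b n) * (norm (\<Phi> a + cnj (b (Suc n))))\<^sup>2
        \<le> Re (\<Phi> a) * Re (b (Suc n)) * (norm (a + cnj (b n)))\<^sup>2"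
      using half_plane_Schwarz_Pick[OF hol pos a b[of n]] by (simp add: orbit)
    moreover have "Re (b k) = m k * (norm (b k))\<^sup>2" for k using b0[of k] by (simp add: m)
    ultimately have "((norm (b n))\<^sup>2 * (norm (b (Suc n)))\<^sup>2) * (m n * lo n)
        \<le> ((norm (b n))\<^sup>2 * (norm (b (Suc n)))\<^sup>2) * (m (Suc n) * up n)"
      by (simp add: factor lo_def up_def power_mult_distrib mult_ac)
    then show ?thesis using b0 by (subst (asm) mult_le_cancel_left_pos) auto
  qed
  have lo: "lo \<longlonglongrightarrow> Re a * (norm (1 + \<Phi> a * cnj 0))\<^sup>2"
    unfolding lo_def by (intro tendsto_intros LIMSEQ_Suc[OF lim])
  have up: "up \<longlonglongrightarrow> Re (\<Phi> a) * (norm (1 + a * cnj 0))\<^sup>2"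
    unfolding up_def by (intro tendsto_intros lim)
  have "(\<lambda>n. lo n - up n) \<longlonglongrightarrow> Re a - Re (\<Phi> a)"
    using tendsto_diff[OF lo up] by simp
  then have "\<forall>\<^sub>F n in sequentially. 0 < lo n - up n"
    by (rule order_tendstoD) (use less in simp)
  then obtain N where N: "\<And>n. N \<le> n \<Longrightarrow> up n < lo n" by (auto simp: eventually_sequentially)
  have incr: "m n \<le> m (Suc n)" if "N \<le> n" for n
  proof (rule ccontr)
    assume "\<not> m n \<le> m (Suc n)"
    then have "m (Suc n) * up n \<le> m n * up n"
      using pos[OF a] by (intro mult_right_mono) (auto simp: up_def)
    also have "\<dots> < m n * lo n" using N[OF that] mpos by simp
    finally show False using step[of n] by simp
  qed
  have "m N \<le> m n" if "N \<le> n" for n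
    using that by (induction rule: dec_induct) (use incr in \<open>auto intro: order_trans\<close>)
  moreover have "m \<longlonglongrightarrow> Re 0" unfolding m_def by (intro tendsto_intros lim)
  ultimately have "m N \<le> 0"
    by (intro LIMSEQ_le_const[of m 0]) auto
  then show False using mpos[of N] by simp
qed

section \<open>Translation, reflection and comparison of trajectories\<close>

context starlike_half_plane_map
begin

text \<open>Otherwise \<open>1 / (1 + f)\<close> is a bounded entire function.\<close>

lemma domain_not_UNIV: "\<Omega> \<noteq> UNIV"
proof
  assume U: "\<Omega> = UNIV"
  define F where "F w = inverse (1 + f w)" for w
  have nz: "1 + f w \<noteq> 0" and big: "1 \<le> norm (1 + f w)" for w
  proof -
    have "1 < Re (1 + f w)" using Re_pos[of w] U by simp
    then show "1 \<le> norm (1 + f w)" by (meson complex_Re_le_cmod less_imp_le order_trans)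
    then show "1 + f w \<noteq> 0" by auto
  qed
  have "F holomorphic_on UNIV"
    unfolding F_def using holf U nz by (intro holomorphic_intros) auto
  moreover have "bounded (range F)"
    unfolding bounded_iff F_def using big
    by (intro exI[of _ 1]) (auto simp: norm_inverse inverse_le_1_iff)
  ultimately have "F constant_on UNIV" by (rule Liouville_theorem)
  then have "F (g 1) = F (g 2)" by (auto simp: constant_on_def)
  then show False by (simp add: F_def fg)
qed

lemma translate: "starlike_half_plane_map {w. p + w \<in> \<Omega>} (\<lambda>w. f (p + w)) (\<lambda>z. g z - p)"
proof
  have "{w. p + w \<in> \<Omega>} = (\<lambda>w. p + w) -` \<Omega>" by auto
  then show "open {w. p + w \<in> \<Omega>}"
    using open_domain by (simp add: continuous_open_vimage)
  show "(\<lambda>w. f (p + w)) holomorphic_on {w. p + w \<in> \<Omega>}"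
    by (rule holomorphic_on_compose_gen[OF _ holf, unfolded o_def]) (auto intro!: holomorphic_intros)
  show "(\<lambda>z. g z - p) holomorphic_on {z. 0 < Re z}" by (intro holomorphic_intros holg)
qed (use starlike Re_pos g_in gf fg Re_mono in \<open>auto simp: add.assoc[symmetric]\<close>)

text \<open>Reflection in the imaginary axis preserves upward translations and exchanges left and right; on the
  half-plane side it becomes conjugation, which changes the sign of \<open>Im f\<close>.\<close>

lemma mirror:
  "starlike_half_plane_map {w. - cnj w \<in> \<Omega>} (\<lambda>w. cnj (f (- cnj w))) (\<lambda>z. - cnj (g (cnj z)))"
proof
  let ?\<Omega> = "{w. - cnj w \<in> \<Omega>}"
  have "?\<Omega> = (\<lambda>w. - cnj w) -` \<Omega>" by auto
  then show op: "open ?\<Omega>"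
    using open_domain by (simp add: continuous_open_vimage)
  have "(\<lambda>w. f (- w)) holomorphic_on cnj ` ?\<Omega>"
    by (rule holomorphic_on_compose_gen[OF _ holf, unfolded o_def]) (auto intro!: holomorphic_intros)
  from holomorphic_on_compose_cnj_cnj[OF this op]
  show "(\<lambda>w. cnj (f (- cnj w))) holomorphic_on ?\<Omega>" by (simp add: o_def)
  have "(\<lambda>z. - g z) holomorphic_on cnj ` {z. 0 < Re z}"
    by (rule holomorphic_on_subset[of _ "{z. 0 < Re z}"]) (auto intro!: holomorphic_intros holg)
  from holomorphic_on_compose_cnj_cnj[OF this]
  show "(\<lambda>z. - cnj (g (cnj z))) holomorphic_on {z. 0 < Re z}"
    by (simp add: o_def open_halfspace_Re_gt)
  have sh: "- cnj (w + \<i> * of_real s) = - cnj w + \<i> * of_real s" for w s by simp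
  show "w + \<i> * of_real s \<in> ?\<Omega>" if "w \<in> ?\<Omega>" "0 \<le> s" for w s
    using starlike[of "- cnj w" s] that sh by simp
  show "Re (cnj (f (- cnj w))) \<le> Re (cnj (f (- cnj (w + \<i> * of_real s))))"
    if "w \<in> ?\<Omega>" "0 \<le> s" for w s
    using Re_mono[of "- cnj w" s] that unfolding sh by simp
qed (use Re_pos g_in gf fg in auto)

text \<open>Translation upwards by \<open>t\<close> acts on the half-plane as the contraction \<open>z \<mapsto> f (g z + \<i> t)\<close>, so two
  trajectories never get farther apart than their starting points. The inequalities are what a bounded
  hyperbolic distance means in coordinates.\<close>

lemma trajectories_comparable:
  assumes v: "v \<in> \<Omega>" and w: "w \<in> \<Omega>"
  obtains K where "0 < K"
    and "\<And>t. 0 \<le> t \<Longrightarrow> Re (f (v + \<i> * of_real t)) \<le> K * Re (f (w + \<i> * of_real t))"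
    and "\<And>t. 0 \<le> t \<Longrightarrow> Re (f (w + \<i> * of_real t)) \<le> K * Re (f (v + \<i> * of_real t))"
    and "\<And>t. 0 \<le> t \<Longrightarrow> \<bar>Im (f (v + \<i> * of_real t)) - Im (f (w + \<i> * of_real t))\<bar>
            \<le> K * Re (f (v + \<i> * of_real t))"
proof -
  define K where "K = (norm (f v + cnj (f w)))\<^sup>2 / (Re (f v) * Re (f w))"
  have K: "0 < K"
    using Re_pos[OF v] Re_pos[OF w] norm_add_cnj_pos[OF Re_pos[OF v] Re_pos[OF w]] by (simp add: K_def)
  have main: "Re a \<le> K * Re b \<and> Re b \<le> K * Re a \<and> \<bar>Im a - Im b\<bar> \<le> K * Re a"
    if t: "0 \<le> t" and ab: "a = f (v + \<i> * of_real t)" "b = f (w + \<i> * of_real t)" for t a b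
  proof -
    have pa: "0 < Re a" and pb: "0 < Re b" using Re_pos starlike v w t ab by auto
    have "(\<lambda>z. f (g z + \<i> * of_real t)) holomorphic_on {z. 0 < Re z}"
      by (rule holomorphic_on_compose_gen[OF _ holf, unfolded o_def])
         (use starlike g_in t in \<open>auto intro!: holomorphic_intros holg\<close>)
    from half_plane_Schwarz_Pick[OF this _ Re_pos[OF v] Re_pos[OF w]]
    have "Re (f v) * Re (f w) * (norm (a + cnj b))\<^sup>2 \<le> Re a * Re b * (norm (f v + cnj (f w)))\<^sup>2"
      using Re_pos starlike g_in t v w by (simp add: gf ab)
    then have "(norm (a + cnj b))\<^sup>2 \<le> K * (Re a * Re b)"
      using Re_pos[OF v] Re_pos[OF w] by (simp add: K_def field_simps)
    then have n: "(Re a + Re b)\<^sup>2 + (Im a - Im b)\<^sup>2 \<le> K * (Re a * Re b)"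
      by (simp add: norm_add_cnj_sq)
    have sq: "(Re a)\<^sup>2 + (Re b)\<^sup>2 \<le> (Re a + Re b)\<^sup>2" using pa pb by (simp add: power2_sum)
    have "(Re a)\<^sup>2 \<le> K * (Re a * Re b)" "(Re b)\<^sup>2 \<le> K * (Re a * Re b)"
      using n sq zero_le_power2[of "Re a"] zero_le_power2[of "Re b"] zero_le_power2[of "Im a - Im b"]
      by linarith+
    then have "Re a * Re a \<le> Re a * (K * Re b)" "Re b * Re b \<le> Re b * (K * Re a)"
      by (simp_all add: power2_eq_square mult_ac)
    then have ab: "Re a \<le> K * Re b" and ba: "Re b \<le> K * Re a"
      using pa pb by (simp_all only: mult_le_cancel_left_pos)
    have "\<bar>Im a - Im b\<bar>\<^sup>2 \<le> K * (Re a * Re b)"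
      unfolding power2_abs using n zero_le_power2[of "Re a + Re b"] by linarith
    also have "\<dots> \<le> K * (Re a * (K * Re a))" using ba K pa by (intro mult_left_mono) auto
    also have "\<dots> = (K * Re a)\<^sup>2" by (simp add: power2_eq_square)
    finally have "\<bar>Im a - Im b\<bar> \<le> K * Re a" by (rule power2_le_imp_le) (use K pa in simp)
    with ab ba show ?thesis by simp
  qed
  show ?thesis by (rule that[OF K]) (use main in blast)+
qed

lemma axis_shift: "Complex 0 r + \<i> * of_real t = Complex 0 (r + t)"
  by (simp add: complex_eq_iff)

lemma eventually_axis_shift:
  assumes "\<forall>\<^sub>F t in at_top. S (Complex 0 t)"
  shows "\<forall>\<^sub>F t in at_top. S (Complex 0 r + \<i> * of_real t)"
proof -
  obtain N where "\<And>t. N \<le> t \<Longrightarrow> S (Complex 0 t)" using assms by (auto simp: eventually_at_top_linorder)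
  then show ?thesis unfolding axis_shift
    by (auto simp: eventually_at_top_linorder intro!: exI[of _ "N - r"])
qed

lemma nontangential_every_trajectory:
  assumes r: "Complex 0 r \<in> \<Omega>" and w: "w \<in> \<Omega>"
    and axis: "\<forall>\<^sub>F t in at_top. \<bar>Im (f (Complex 0 t))\<bar> \<le> M * Re (f (Complex 0 t))"
  shows "\<exists>M. \<forall>\<^sub>F t in at_top. \<bar>Im (f (w + \<i> * of_real t))\<bar> \<le> M * Re (f (w + \<i> * of_real t))"
proof -
  obtain K where K: "0 < K"
    "\<And>t. 0 \<le> t \<Longrightarrow> Re (f (Complex 0 r + \<i> * of_real t)) \<le> K * Re (f (w + \<i> * of_real t))"
    "\<And>t. 0 \<le> t \<Longrightarrow> \<bar>Im (f (w + \<i> * of_real t)) - Im (f (Complex 0 r + \<i> * of_real t))\<bar>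
        \<le> K * Re (f (w + \<i> * of_real t))"
    using trajectories_comparable[OF w r] by metis
  have "\<forall>\<^sub>F t in at_top. \<bar>Im (f (w + \<i> * of_real t))\<bar> \<le> (\<bar>M\<bar> * K + K) * Re (f (w + \<i> * of_real t))"
    using eventually_axis_shift[OF axis, of r] eventually_ge_at_top[of 0]
  proof eventually_elim
    case (elim t)
    let ?a = "f (w + \<i> * of_real t)" and ?b = "f (Complex 0 r + \<i> * of_real t)"
    have "0 < Re ?b" using Re_pos[OF starlike[OF r elim(2)]] .
    then have "M * Re ?b \<le> \<bar>M\<bar> * Re ?b" by (intro mult_right_mono) auto
    also have "\<dots> \<le> \<bar>M\<bar> * (K * Re ?a)" using K(2)[OF elim(2)] by (intro mult_left_mono) auto
    finally show ?case using elim(1) K(3)[OF elim(2)] by (simp add: algebra_simps)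
  qed
  then show ?thesis by blast
qed

lemma tangential_every_trajectory:
  assumes r: "Complex 0 r \<in> \<Omega>" and w: "w \<in> \<Omega>"
    and axis: "\<And>M. \<forall>\<^sub>F t in at_top. Im (f (Complex 0 t)) \<le> - M * Re (f (Complex 0 t))"
  shows "\<forall>\<^sub>F t in at_top. Im (f (w + \<i> * of_real t)) \<le> - M * Re (f (w + \<i> * of_real t))"
proof -
  obtain K where K: "0 < K"
    "\<And>t. 0 \<le> t \<Longrightarrow> Re (f (w + \<i> * of_real t)) \<le> K * Re (f (Complex 0 r + \<i> * of_real t))"
    "\<And>t. 0 \<le> t \<Longrightarrow> \<bar>Im (f (w + \<i> * of_real t)) - Im (f (Complex 0 r + \<i> * of_real t))\<bar>
        \<le> K * Re (f (w + \<i> * of_real t))"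
    using trajectories_comparable[OF w r] by metis
  define N where "N = \<bar>M\<bar> + K"
  show ?thesis
    using eventually_axis_shift[OF axis[of "K * N"], of r] eventually_ge_at_top[of 0]
  proof eventually_elim
    case (elim t)
    let ?a = "f (w + \<i> * of_real t)" and ?b = "f (Complex 0 r + \<i> * of_real t)"
    have pa: "0 < Re ?a" using Re_pos[OF starlike[OF w elim(2)]] .
    have "N * Re ?a \<le> N * (K * Re ?b)" using K(1) K(2)[OF elim(2)] by (intro mult_left_mono) (auto simp: N_def)
    then have "Im ?b \<le> - (N * Re ?a)" using elim(1) by (simp add: mult_ac)
    then have "Im ?a \<le> - (N * Re ?a) + K * Re ?a" using K(3)[OF elim(2)] by linarith
    also have "\<dots> = - (\<bar>M\<bar> * Re ?a)" by (simp add: N_def algebra_simps)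
    also have "\<dots> \<le> - (M * Re ?a)" using pa by (simp add: mult_right_mono)
    finally show ?case by simp
  qed
qed

end

section \<open>Slope sets and the Cayley transform\<close>

lemma slope_set_eq_singleton:
  assumes lim: "((\<lambda>t. Arg (1 - cnj \<tau> * \<gamma> t)) \<longlongrightarrow> \<theta>) at_top" and \<theta>: "\<theta> \<in> {-pi/2..pi/2}"
  shows "slope_set \<gamma> \<tau> = {\<theta>}"
proof -
  have along: "(\<lambda>n. Arg (1 - cnj \<tau> * \<gamma> (t n))) \<longlonglongrightarrow> \<theta>" if "filterlim t at_top sequentially" for t :: "nat \<Rightarrow> real"
    using filterlim_compose[OF lim that] .
  have "\<theta> \<in> slope_set \<gamma> \<tau>"
    unfolding slope_set_def using \<theta> along[OF filterlim_real_sequentially] filterlim_real_sequentially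
    by (auto intro!: exI[of _ real])
  moreover have "\<theta>' = \<theta>" if "\<theta>' \<in> slope_set \<gamma> \<tau>" for \<theta>'
    using that along unfolding slope_set_def by (auto intro: LIMSEQ_unique)
  ultimately show ?thesis by blast
qed

lemma slope_set_subset_if_eventually_bounded:
  assumes "\<forall>\<^sub>F t in at_top. \<bar>Arg (1 - cnj \<tau> * \<gamma> t)\<bar> \<le> B"
  shows "slope_set \<gamma> \<tau> \<subseteq> {-B..B}"
proof
  fix \<theta> assume "\<theta> \<in> slope_set \<gamma> \<tau>"
  then obtain t where t: "filterlim t at_top sequentially" "(\<lambda>n. Arg (1 - cnj \<tau> * \<gamma> (t n))) \<longlonglongrightarrow> \<theta>"
    unfolding slope_set_def by blast
  have "\<forall>\<^sub>F n in sequentially. \<bar>Arg (1 - cnj \<tau> * \<gamma> (t n))\<bar> \<le> B"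
    using filterlim_iff[THEN iffD1, OF t(1)] assms by blast
  then have "\<forall>\<^sub>F n in sequentially. Arg (1 - cnj \<tau> * \<gamma> (t n)) \<in> {-B..B}"
    by eventually_elim auto
  then show "\<theta> \<in> {-B..B}"
    by (rule Lim_in_closed_set[OF closed_atLeastAtMost _ trivial_limit_sequentially t(2)])
qed

text \<open>The slope set is the set of cluster points of the argument, hence an intersection of closed sets.\<close>

lemma compact_slope_set: "compact (slope_set \<gamma> \<tau>)"
proof -
  define A where "A t = Arg (1 - cnj \<tau> * \<gamma> t)" for t
  have "slope_set \<gamma> \<tau> = {-pi/2..pi/2} \<inter> (\<Inter>n. closure (A ` {real n..}))"
  proof (intro equalityI subsetI)
    fix \<theta> assume th: "\<theta> \<in> slope_set \<gamma> \<tau>"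
    then obtain t where t: "filterlim t at_top sequentially" "(\<lambda>n. A (t n)) \<longlonglongrightarrow> \<theta>"
      unfolding slope_set_def A_def by blast
    have "\<theta> \<in> closure (A ` {real n..})" for n
    proof -
      have "\<forall>\<^sub>F k in sequentially. real n \<le> t k" using t(1) by (simp add: filterlim_at_top)
      then have "\<forall>\<^sub>F k in sequentially. A (t k) \<in> closure (A ` {real n..})"
        by eventually_elim (use closure_subset in fastforce)
      then show ?thesis
        by (rule Lim_in_closed_set[OF closed_closure _ trivial_limit_sequentially t(2)])
    qed
    then show "\<theta> \<in> {-pi/2..pi/2} \<inter> (\<Inter>n. closure (A ` {real n..}))"
      using th by (auto simp: slope_set_def)
  next
    fix \<theta> assume th: "\<theta> \<in> {-pi/2..pi/2} \<inter> (\<Inter>n. closure (A ` {real n..}))"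
    have "\<exists>s\<ge>real n. dist (A s) \<theta> < inverse (real (Suc n))" for n
    proof -
      have "\<theta> \<in> closure (A ` {real n..})" using th by blast
      then have "\<exists>y\<in>A ` {real n..}. dist y \<theta> < inverse (real (Suc n))"
        by (subst (asm) closure_approachable) (simp del: of_nat_Suc)
      then show ?thesis by auto
    qed
    then obtain t where t: "\<And>n. real n \<le> t n" "\<And>n. dist (A (t n)) \<theta> < inverse (real (Suc n))" by metis
    have "(\<lambda>n. A (t n)) \<longlonglongrightarrow> \<theta>"
      by (rule metric_tendsto_imp_tendsto[OF LIMSEQ_inverse_real_of_nat])
         (use t(2) in \<open>auto intro!: always_eventually less_imp_le simp del: of_nat_Suc\<close>)
    moreover have "filterlim t at_top sequentially"
      by (rule filterlim_at_top_mono[OF filterlim_real_sequentially]) (use t(1) in simp)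
    moreover have "0 \<le> t n" for n using t(1)[of n] by (meson of_nat_0_le_iff order_trans)
    ultimately show "\<theta> \<in> slope_set \<gamma> \<tau>" using th unfolding slope_set_def A_def by blast
  qed
  moreover have "compact ({-pi/2..pi/2} \<inter> (\<Inter>n. closure (A ` {real n..})))"
    by (intro compact_Int_closed) auto
  ultimately show ?thesis by simp
qed

definition cayley :: "complex \<Rightarrow> complex" where "cayley \<omega> = (1 + \<omega>) / (1 - \<omega>)"

lemma Re_cayley: "Re (cayley \<omega>) = (1 - (norm \<omega>)\<^sup>2) / (norm (1 - \<omega>))\<^sup>2"
proof -
  have "cayley \<omega> = (1 + \<omega>) * cnj (1 - \<omega>) / of_real ((norm (1 - \<omega>))\<^sup>2)"
    unfolding cayley_def by (rule complex_div_cnj)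
  moreover have "Re ((1 + \<omega>) * cnj (1 - \<omega>)) = 1 - (norm \<omega>)\<^sup>2"
    unfolding cmod_power2 by (simp add: power2_eq_square algebra_simps)
  ultimately show ?thesis by (metis Re_divide_of_real)
qed

lemma Re_cayley_pos: "norm \<omega> < 1 \<Longrightarrow> 0 < Re (cayley \<omega>)"
  unfolding Re_cayley by (auto simp: abs_square_less_1 intro!: divide_pos_pos)

text \<open>\<open>1 - \<omega>\<close> equals \<open>2 / (1 + cayley \<omega>)\<close>.\<close>

lemma Arg_one_minus_eq:
  assumes "norm \<omega> < 1"
  shows "Arg (1 - \<omega>) = - arctan (Im (cayley \<omega>) / (1 + Re (cayley \<omega>)))"
proof -
  define c where "c = 1 + cayley \<omega>"
  have ne: "1 - \<omega> \<noteq> 0" using assms by auto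
  have Rc: "0 < Re c" using Re_cayley_pos[OF assms] by (simp add: c_def)
  then have c0: "c \<noteq> 0" by auto
  have "c = 2 / (1 - \<omega>)" using ne by (simp add: c_def cayley_def field_simps)
  then have "1 - \<omega> = 2 / c" using ne by simp
  then have eq: "1 - \<omega> = (2 * cnj c) / of_real ((norm c)\<^sup>2)" by (simp only: complex_div_cnj[of 2 c])
  have re: "Re (1 - \<omega>) = 2 * Re c / (norm c)\<^sup>2" and im: "Im (1 - \<omega>) = - (2 * Im c) / (norm c)\<^sup>2"
    unfolding eq by (simp_all only: Re_divide_of_real Im_divide_of_real) simp_all
  have "0 < Re (1 - \<omega>)" using re Rc c0 by simp
  then have "Arg (1 - \<omega>) = arctan (Im (1 - \<omega>) / Re (1 - \<omega>))" by (rule arg_conv_arctan)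
  also have "Im (1 - \<omega>) / Re (1 - \<omega>) = - (Im c / Re c)"
    unfolding re im using Rc c0 by (simp add: field_simps)
  finally show ?thesis by (simp add: arctan_minus c_def)
qed

lemma nontangential_if_cayley_in_sector:
  assumes \<gamma>: "\<And>t. 0 \<le> t \<Longrightarrow> norm (cnj \<tau> * \<gamma> t) < 1" and lim: "(\<gamma> \<longlongrightarrow> \<tau>) at_top"
    and sector: "\<forall>\<^sub>F t in at_top. \<bar>Im (cayley (cnj \<tau> * \<gamma> t))\<bar> \<le> M * Re (cayley (cnj \<tau> * \<gamma> t))"
  shows "converges_nontangentially \<gamma> \<tau>"
proof -
  have "\<forall>\<^sub>F t in at_top. \<bar>Arg (1 - cnj \<tau> * \<gamma> t)\<bar> \<le> arctan \<bar>M\<bar>"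
    using sector eventually_ge_at_top[of 0]
  proof eventually_elim
    case (elim t)
    let ?a = "cayley (cnj \<tau> * \<gamma> t)"
    have p: "0 < Re ?a" using Re_cayley_pos \<gamma> elim by blast
    have "M * Re ?a \<le> \<bar>M\<bar> * (1 + Re ?a)" using p by (intro mult_mono) auto
    then have "\<bar>Im ?a\<bar> \<le> \<bar>M\<bar> * (1 + Re ?a)" using elim by linarith
    then have "\<bar>Im ?a\<bar> / \<bar>1 + Re ?a\<bar> \<le> \<bar>M\<bar>" using p by (simp add: divide_le_eq)
    then have "\<bar>Im ?a / (1 + Re ?a)\<bar> \<le> \<bar>M\<bar>" by (simp only: abs_divide)
    then have "arctan (Im ?a / (1 + Re ?a)) \<le> arctan \<bar>M\<bar>" "arctan (- \<bar>M\<bar>) \<le> arctan (Im ?a / (1 + Re ?a))"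
      unfolding arctan_le_iff by linarith+
    then show ?case using Arg_one_minus_eq[OF \<gamma>[OF elim(2)]] by (simp add: arctan_minus abs_le_iff)
  qed
  then have "slope_set \<gamma> \<tau> \<subseteq> {- arctan \<bar>M\<bar>..arctan \<bar>M\<bar>}"
    by (rule slope_set_subset_if_eventually_bounded)
  also have "\<dots> \<subseteq> {-pi/2<..<pi/2}" using arctan_ubound[of "\<bar>M\<bar>"] by auto
  finally show ?thesis using lim compact_slope_set by (auto simp: converges_nontangentially_def)
qed

text \<open>The sign \<open>\<sigma>\<close> covers both sides at once. The lower bound \<open>x0\<close> is needed because the argument involves
  \<open>1 + Re\<close> instead of \<open>Re\<close>.\<close>

lemma slope_set_if_cayley_tangential:
  assumes \<sigma>: "\<sigma> = 1 \<or> \<sigma> = -1" and \<gamma>: "\<And>t. 0 \<le> t \<Longrightarrow> norm (cnj \<tau> * \<gamma> t) < 1" and x0: "0 < x0"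
    and low: "\<And>t. 0 \<le> t \<Longrightarrow> x0 \<le> Re (cayley (cnj \<tau> * \<gamma> t))"
    and tang: "\<And>M. \<forall>\<^sub>F t in at_top. \<sigma> * Im (cayley (cnj \<tau> * \<gamma> t)) \<le> - M * Re (cayley (cnj \<tau> * \<gamma> t))"
  shows "slope_set \<gamma> \<tau> = {\<sigma> * (pi/2)}"
proof (rule slope_set_eq_singleton)
  define q where "q t = - (\<sigma> * Im (cayley (cnj \<tau> * \<gamma> t))) / (1 + Re (cayley (cnj \<tau> * \<gamma> t)))" for t
  have "filterlim q at_top at_top"
    unfolding filterlim_at_top
  proof
    fix Z :: real
    define M where "M = \<bar>Z\<bar> * (1 + 1 / x0)"
    show "\<forall>\<^sub>F t in at_top. Z \<le> q t"
      using tang[of M] eventually_ge_at_top[of 0]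
    proof eventually_elim
      case (elim t)
      let ?x = "Re (cayley (cnj \<tau> * \<gamma> t))"
      have x: "x0 \<le> ?x" using low elim by blast
      have "1 + ?x \<le> (1 + 1 / x0) * ?x" using x x0 by (simp add: field_simps)
      then have "\<bar>Z\<bar> * (1 + ?x) \<le> \<bar>Z\<bar> * ((1 + 1 / x0) * ?x)" by (intro mult_left_mono) auto
      also have "\<dots> = M * ?x" by (simp add: M_def)
      finally have "\<bar>Z\<bar> * (1 + ?x) \<le> - (\<sigma> * Im (cayley (cnj \<tau> * \<gamma> t)))" using elim by simp
      moreover have "0 < 1 + ?x" using x x0 by simp
      ultimately have "\<bar>Z\<bar> \<le> q t" unfolding q_def by (subst pos_le_divide_eq)
      then show ?case by simp
    qed
  qed
  then have "((\<lambda>t. arctan (q t)) \<longlongrightarrow> pi / 2) at_top"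
    by (rule filterlim_compose[OF tendsto_arctan_at_top])
  then have "((\<lambda>t. \<sigma> * arctan (q t)) \<longlongrightarrow> \<sigma> * (pi / 2)) at_top" by (intro tendsto_intros)
  moreover have "\<forall>\<^sub>F t in at_top. \<sigma> * arctan (q t) = Arg (1 - cnj \<tau> * \<gamma> t)"
    using eventually_ge_at_top[of 0]
  proof eventually_elim
    case (elim t)
    show ?case using Arg_one_minus_eq[OF \<gamma>[OF elim]] \<sigma> by (auto simp: q_def arctan_minus)
  qed
  ultimately show "((\<lambda>t. Arg (1 - cnj \<tau> * \<gamma> t)) \<longlongrightarrow> \<sigma> * (pi / 2)) at_top"
    by (rule Lim_transform_eventually)
  show "\<sigma> * (pi / 2) \<in> {-pi/2..pi/2}" using \<sigma> by auto
qed

section \<open>Angular extents\<close>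

text \<open>Passage from the circular arcs in the angular extents to horizontal segments.\<close>

lemma arc_param:
  assumes "0 < t" "0 \<le> u"
  defines "r \<equiv> sqrt (t\<^sup>2 + u\<^sup>2)" and "\<theta> \<equiv> arctan (u / t)"
  shows "\<i> * of_real r * exp (\<i> * of_real \<theta>) = Complex (- u) t"
proof -
  have "sqrt (1 + (u / t)\<^sup>2) = r / t"
  proof -
    have "1 + (u / t)\<^sup>2 = (t\<^sup>2 + u\<^sup>2) / t\<^sup>2" using assms(1) by (simp add: field_simps)
    then show ?thesis using assms(1) by (simp add: r_def real_sqrt_divide)
  qed
  moreover have "0 < r" using assms(1) by (simp add: r_def add_pos_nonneg)
  ultimately have "r * cos \<theta> = t" "r * sin \<theta> = u"
    using assms(1) by (simp_all add: \<theta>_def cos_arctan sin_arctan)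
  then show ?thesis by (simp add: complex_eq_iff Re_exp Im_exp)
qed

text \<open>A point at height \<open>t\<close> lies on a circle of radius at least \<open>t\<close>, so the lower bound on the extent is
  available there, and \<open>8 \<eta> = tan \<beta>\<close> (or \<open>1\<close>) keeps the angle below the extent.\<close>

lemma wide_if_Liminf_left_extent_pos:
  assumes "0 < Liminf at_top (left_extent S 0)"
  obtains \<eta> R where "0 < \<eta>" "\<eta> \<le> 1/8" "0 < R"
    "\<And>t u. R \<le> t \<Longrightarrow> 0 \<le> u \<Longrightarrow> u \<le> 8 * (\<eta> * t) \<Longrightarrow> Complex (- u) t \<in> S"
proof -
  obtain y where y: "0 < ereal y" "ereal y < Liminf at_top (left_extent S 0)"
    using assms ereal_dense2 by blast
  have "\<forall>\<^sub>F t in at_top. ereal y < left_extent S 0 t"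
    using y(2) le_Liminf_iff[of "Liminf at_top (left_extent S 0)"] by blast
  then obtain R0 where R0: "\<And>t. R0 \<le> t \<Longrightarrow> ereal y < left_extent S 0 t"
    by (auto simp: eventually_at_top_linorder)
  define \<beta> where "\<beta> = min y 1"
  define \<eta> where "\<eta> = min 1 (tan \<beta>) / 8"
  have pi2: "1 < pi / 2" using pi_gt3 by simp
  have b: "0 < \<beta>" "\<beta> \<le> y" "\<beta> < pi / 2" using y pi2 by (auto simp: \<beta>_def)
  have tan: "0 < tan \<beta>" using b by (intro tan_gt_zero) auto
  show thesis
  proof (rule that[of \<eta> "max R0 1"])
    show "0 < \<eta>" "\<eta> \<le> 1/8" using tan by (auto simp: \<eta>_def)
    fix t u :: real assume t: "max R0 1 \<le> t" and u: "0 \<le> u" "u \<le> 8 * (\<eta> * t)"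
    define r where "r = sqrt (t\<^sup>2 + u\<^sup>2)"
    have "sqrt (t\<^sup>2) \<le> r" unfolding r_def by (rule real_sqrt_le_mono) simp
    then have "R0 \<le> r" using t by simp
    from R0[OF this] obtain \<alpha> where \<alpha>: "y < \<alpha>"
      "\<And>\<theta>. \<theta> \<in> {0..\<alpha>} \<Longrightarrow> 0 + \<i> * of_real r * exp (\<i> * of_real \<theta>) \<in> S"
      unfolding left_extent_def by (auto simp: less_Sup_iff)
    have "u \<le> (8 * \<eta>) * t" using u by simp
    also have "\<dots> \<le> tan \<beta> * t" using t by (intro mult_right_mono) (auto simp: \<eta>_def)
    finally have "u / t \<le> tan \<beta>" using t by (simp add: field_simps)
    then have "arctan (u / t) \<le> arctan (tan \<beta>)" by (simp add: arctan_le_iff)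
    also have "\<dots> = \<beta>" using b by (intro arctan_tan) auto
    finally have "arctan (u / t) \<in> {0..\<alpha>}" using b \<alpha>(1) u t by simp
    from \<alpha>(2)[OF this] show "Complex (- u) t \<in> S"
      using arc_param[of t u] t u by (simp add: r_def)
  qed simp
qed

text \<open>If the extent is less than \<open>\<delta>\<close>, the arc of angle \<open>\<delta>\<close> leaves the set, and its length is \<open>\<delta> t\<close>.\<close>

lemma narrow_if_right_extent_tendsto_0:
  assumes lim: "(right_extent S 0 \<longlongrightarrow> 0) at_top" and e: "0 < \<epsilon>"
  shows "\<forall>\<^sub>F t in at_top. \<exists>w. w \<notin> S \<and> norm (w - Complex 0 t) \<le> \<epsilon> * t"
proof -
  define \<delta> where "\<delta> = min \<epsilon> 1"
  have d: "0 < \<delta>" "\<delta> \<le> \<epsilon>" "\<delta> < pi" using e pi_gt3 by (auto simp: \<delta>_def)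
  have "\<forall>\<^sub>F t in at_top. right_extent S 0 t < ereal \<delta>"
    using lim by (rule order_tendstoD) (use d in simp)
  then show ?thesis
    using eventually_gt_at_top[of 0]
  proof eventually_elim
    case (elim t)
    have "\<delta> \<notin> {\<alpha>. \<alpha> > 0 \<and> (\<forall>\<theta>\<in>{0..\<alpha>}. 0 + \<i> * of_real t * exp (- \<i> * of_real \<theta>) \<in> S)}" (is "_ \<notin> ?A")
    proof
      assume "\<delta> \<in> ?A"
      then have "ereal \<delta> \<le> Sup (ereal ` ?A)" by (intro Sup_upper imageI)
      then show False using elim(1) d(3) by (auto simp: right_extent_def min_def split: if_splits)
    qed
    then obtain \<theta> where th: "0 \<le> \<theta>" "\<theta> \<le> \<delta>" "\<i> * of_real t * exp (- \<i> * of_real \<theta>) \<notin> S"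
      using d by auto
    have "\<i> * of_real t * exp (- \<i> * of_real \<theta>) - Complex 0 t = \<i> * of_real t * (cis (- \<theta>) - cis 0)"
      by (simp add: cis_conv_exp complex_eq_iff Re_exp Im_exp algebra_simps)
    then have "norm (\<i> * of_real t * exp (- \<i> * of_real \<theta>) - Complex 0 t) = t * norm (cis (- \<theta>) - cis 0)"
      using elim(2) by (simp add: norm_mult)
    also have "norm (cis (- \<theta>) - cis 0) \<le> \<theta>"
    proof -
      have "norm (cis (- \<theta>) - cis 0) = 2 * \<bar>sin (\<theta> / 2)\<bar>"
        using dist_exp_i_1[of "- \<theta>"] by (simp add: cis_conv_exp dist_norm)
      then show ?thesis using abs_sin_x_le_abs_x[of "\<theta> / 2"] th by simp
    qed
    finally have "norm (\<i> * of_real t * exp (- \<i> * of_real \<theta>) - Complex 0 t) \<le> \<epsilon> * t"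
      using elim(2) th(2) d(2) by (smt (verit) mult.commute mult_right_mono)
    with th(3) show ?case by blast
  qed
qed

lemma left_extent_translate: "left_extent S p t = left_extent {w. p + w \<in> S} 0 t"
  by (simp add: left_extent_def)

lemma right_extent_translate: "right_extent S p t = right_extent {w. p + w \<in> S} 0 t"
  by (simp add: right_extent_def)

lemma extent_mirror_arc:
  "- cnj (\<i> * of_real t * exp (\<i> * of_real \<theta>)) = \<i> * of_real t * exp (- \<i> * of_real \<theta>)"
  by (simp add: exp_cnj)

text \<open>Reflection lets the statements about the left extent serve for the right one as well.\<close>

lemma right_extent_mirror: "right_extent S 0 t = left_extent {w. - cnj w \<in> S} 0 t"
  unfolding left_extent_def right_extent_def mem_Collect_eq add_0 extent_mirror_arc ..

lemma left_extent_mirror: "left_extent S 0 t = right_extent {w. - cnj w \<in> S} 0 t"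
  using right_extent_mirror[of "{w. - cnj w \<in> S}" t] by simp

context starlike_half_plane_map
begin

lemma tangential_of_extents:
  assumes "0 < Liminf at_top (left_extent \<Omega> 0)" "(right_extent \<Omega> 0 \<longlongrightarrow> 0) at_top" and w: "w \<in> \<Omega>"
  shows "\<forall>\<^sub>F t in at_top. Im (f (w + \<i> * of_real t)) \<le> - M * Re (f (w + \<i> * of_real t))"
proof -
  obtain \<eta> R where wide_left: "0 < \<eta>" "\<eta> \<le> 1/8" "0 < R"
    "\<And>t u. R \<le> t \<Longrightarrow> 0 \<le> u \<Longrightarrow> u \<le> 8 * (\<eta> * t) \<Longrightarrow> Complex (- u) t \<in> \<Omega>"
    using wide_if_Liminf_left_extent_pos[OF assms(1)] by blast
  interpret left_wide_map \<Omega> f g \<eta> R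
    by unfold_locales (use wide_left in auto)
  have "Complex 0 R \<in> \<Omega>" using wide_left(4)[of R 0] wide_left(1-3) by simp
  then show ?thesis
    using tangential_if_narrow_on_the_right[OF narrow_if_right_extent_tendsto_0[OF assms(2)]] w
    by (intro tangential_every_trajectory)
qed

lemma nontangential_of_extents:
  assumes l: "0 < Liminf at_top (left_extent \<Omega> 0)" and r: "0 < Liminf at_top (right_extent \<Omega> 0)"
    and w: "w \<in> \<Omega>"
  shows "\<exists>M. \<forall>\<^sub>F t in at_top. \<bar>Im (f (w + \<i> * of_real t))\<bar> \<le> M * Re (f (w + \<i> * of_real t))"
proof -
  obtain \<eta>1 R1 where 1: "0 < \<eta>1" "\<eta>1 \<le> 1/8" "0 < R1"
    "\<And>t u. R1 \<le> t \<Longrightarrow> 0 \<le> u \<Longrightarrow> u \<le> 8 * (\<eta>1 * t) \<Longrightarrow> Complex (- u) t \<in> \<Omega>"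
    using wide_if_Liminf_left_extent_pos[OF l] by blast
  have "right_extent \<Omega> 0 = left_extent {w. - cnj w \<in> \<Omega>} 0"
    by (rule ext) (rule right_extent_mirror)
  with r obtain \<eta>2 R2 where 2: "0 < \<eta>2" "\<eta>2 \<le> 1/8" "0 < R2"
    "\<And>t u. R2 \<le> t \<Longrightarrow> 0 \<le> u \<Longrightarrow> u \<le> 8 * (\<eta>2 * t) \<Longrightarrow> Complex (- u) t \<in> {w. - cnj w \<in> \<Omega>}"
    using wide_if_Liminf_left_extent_pos[of "{w. - cnj w \<in> \<Omega>}"] by metis
  define \<eta> where "\<eta> = min \<eta>1 \<eta>2"
  define R where "R = 2 * max R1 R2"
  have eta: "0 < \<eta>" "\<eta> \<le> 1/8" "\<eta> \<le> \<eta>1" "\<eta> \<le> \<eta>2" using 1 2 by (auto simp: \<eta>_def)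
  have R: "0 < R" "2 * R1 \<le> R" "2 * R2 \<le> R" using 1 2 by (auto simp: R_def)
  have ball: "ball (Complex 0 t) (4 * \<eta> * t) \<subseteq> \<Omega>" if t: "R \<le> t" for t
  proof
    fix z assume "z \<in> ball (Complex 0 t) (4 * \<eta> * t)"
    then have z: "norm (z - Complex 0 t) < 4 * \<eta> * t" by (simp add: dist_norm norm_minus_commute)
    have re: "\<bar>Re z\<bar> < 4 * \<eta> * t" and im: "\<bar>Im z - t\<bar> < 4 * \<eta> * t"
      using abs_Re_le_cmod[of "z - Complex 0 t"] abs_Im_le_cmod[of "z - Complex 0 t"] z by auto
    have t0: "0 < t" using t R by simp
    have "\<eta> * t \<le> t / 8" using mult_right_mono[OF eta(2), of t] t0 by simp
    then have half: "t / 2 \<le> Im z" using im by linarith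
    then have "\<eta> * (t / 2) \<le> \<eta> * Im z" using eta by (intro mult_left_mono) auto
    moreover have "\<eta> * Im z \<le> \<eta>1 * Im z" "\<eta> * Im z \<le> \<eta>2 * Im z"
      using eta half t0 by (auto intro!: mult_right_mono)
    ultimately have small: "\<bar>Re z\<bar> \<le> 8 * (\<eta>1 * Im z)" "\<bar>Re z\<bar> \<le> 8 * (\<eta>2 * Im z)" using re by linarith+
    show "z \<in> \<Omega>"
    proof (cases "Re z \<le> 0")
      case True
      then have "Complex (- (- Re z)) (Im z) \<in> \<Omega>"
        by (intro 1(4)) (use small half t R in auto)
      then show ?thesis by simp
    next
      case False
      then have "Complex (- Re z) (Im z) \<in> {w. - cnj w \<in> \<Omega>}"
        by (intro 2(4)) (use small half t R in auto)
      moreover have "- cnj (Complex (- Re z) (Im z)) = z" by (simp add: complex_eq_iff)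
      ultimately show ?thesis by simp
    qed
  qed
  obtain q where q: "q \<notin> \<Omega>" using domain_not_UNIV by blast
  obtain K where K: "\<forall>\<^sub>F t in at_top. \<bar>Im (f (Complex 0 t))\<bar> \<le> K * Re (f (Complex 0 t))"
    using nontangential_if_wide_on_both_sides[OF R(1) _ ball q] eta by auto
  have "Complex 0 R \<in> \<Omega>" using 1(4)[of R 0] 1(1-3) R by simp
  from nontangential_every_trajectory[OF this w K] show ?thesis .
qed

end

section \<open>The half-plane model of a non-elliptic semigroup\<close>

text \<open>The map is \<open>f w = cayley (cnj \<tau> * h\<inverse> w)\<close>. Its monotonicity is Julia's lemma for the map that translation by
  \<open>\<i> s\<close> induces on the half-plane, with the orbit \<open>b\<close> of \<open>f w\<close>, which tends to infinity because
  \<open>\<phi> (n s) z\<close> tends to \<open>\<tau>\<close>.\<close>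

lemma koenigs_half_plane_map:
  assumes sg: "semigroup_in_disk \<phi>" and DW: "DW_point \<phi> \<tau>" and K: "koenigs_function \<phi> h"
  obtains f g where "starlike_half_plane_map (h ` unit_disk) f g"
    and "\<And>z t. z \<in> unit_disk \<Longrightarrow> 0 \<le> t \<Longrightarrow> f (h z + \<i> * of_real t) = cayley (cnj \<tau> * \<phi> t z)"
proof -
  have \<tau>: "norm \<tau> = 1" and lim: "\<And>z. z \<in> unit_disk \<Longrightarrow> ((\<lambda>t. \<phi> t z) \<longlongrightarrow> \<tau>) at_top"
    using DW by (auto simp: DW_point_def)
  have hol: "h holomorphic_on unit_disk" and inj: "inj_on h unit_disk"
    and shift: "\<And>z t. z \<in> unit_disk \<Longrightarrow> 0 \<le> t \<Longrightarrow> h (\<phi> t z) = h z + \<i> * of_real t"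
    using K by (auto simp: koenigs_function_def)
  have self: "\<phi> t z \<in> unit_disk" if "z \<in> unit_disk" "0 \<le> t" for t z
    using sg that unfolding semigroup_in_disk_def by blast
  obtain k where holk: "k holomorphic_on (h ` unit_disk)" and kh: "\<And>z. z \<in> unit_disk \<Longrightarrow> k (h z) = z"
    using holomorphic_has_inverse[OF hol open_ball inj] by metis
  have tt: "cnj \<tau> * \<tau> = 1" "\<tau> * cnj \<tau> = 1"
    using \<tau> by (simp_all add: complex_norm_square[symmetric] mult.commute)
  define f where "f w = cayley (cnj \<tau> * k w)" for w
  define g where "g z = h (\<tau> * ((z - 1) / (z + 1)))" for z
  have in_disk: "cnj \<tau> * z \<in> unit_disk" if "z \<in> unit_disk" for z
    using that \<tau> by (simp add: norm_mult)
  have fh: "f (h z) = cayley (cnj \<tau> * z)" if "z \<in> unit_disk" for z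
    unfolding f_def kh[OF that] ..
  have Cinv: "(z - 1) / (z + 1) \<in> unit_disk" if "0 < Re z" for z
  proof -
    have "norm (z - 1) < norm (z + cnj 1)" using that by (intro norm_diff_less_norm_add_cnj) auto
    then have "norm (z - 1) < norm (z + 1)" by simp
    moreover have "0 < norm (z + 1)" using calculation norm_ge_zero le_less_trans by blast
    ultimately show ?thesis by (simp add: norm_divide)
  qed
  have gin: "\<tau> * ((z - 1) / (z + 1)) \<in> unit_disk" if "0 < Re z" for z
    using Cinv[OF that] by (simp only: mem_ball_0 norm_mult \<tau> mult_1)
  have cay: "cayley ((z - 1) / (z + 1)) = z" if "0 < Re z" for z
  proof -
    have ne: "z + 1 \<noteq> 0" using that by (auto simp: add_eq_0_iff2)
    then have "1 + (z - 1) / (z + 1) = 2 * z / (z + 1)" "1 - (z - 1) / (z + 1) = 2 / (z + 1)"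
      by (simp_all add: field_simps)
    then show ?thesis using ne by (simp add: cayley_def)
  qed
  have yac: "(cayley \<omega> - 1) / (cayley \<omega> + 1) = \<omega>" if "\<omega> \<in> unit_disk" for \<omega>
  proof -
    have "1 - \<omega> \<noteq> 0" using that by auto
    then show ?thesis by (simp add: cayley_def field_simps)
  qed
  have fshift: "f (h z + \<i> * of_real t) = cayley (cnj \<tau> * \<phi> t z)" if "z \<in> unit_disk" "0 \<le> t" for z t
    using fh[OF self[OF that]] shift[OF that] by simp
  have star: "w + \<i> * of_real s \<in> h ` unit_disk" if w: "w \<in> h ` unit_disk" and s: "0 \<le> s" for w s
  proof -
    obtain z where "z \<in> unit_disk" "w = h z" using w by blast
    then show ?thesis using shift[of z s] self[of z s] s by (metis imageI)
  qed
  have Rf: "0 < Re (f w)" if "w \<in> h ` unit_disk" for w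
    using that fh Re_cayley_pos in_disk by auto
  have holf: "f holomorphic_on h ` unit_disk"
  proof -
    have "cnj \<tau> * k w \<noteq> 1" if "w \<in> h ` unit_disk" for w
      using that kh in_disk by fastforce
    then show ?thesis unfolding f_def cayley_def by (intro holomorphic_intros holk) auto
  qed
  have holg: "g holomorphic_on {z. 0 < Re z}"
    unfolding g_def
  proof (rule holomorphic_on_compose_gen[OF _ hol, unfolded o_def])
    have "z + 1 \<noteq> 0" if "0 < Re z" for z :: complex
      using that by (auto simp: add_eq_0_iff2)
    then show "(\<lambda>z. \<tau> * ((z - 1) / (z + 1))) holomorphic_on {z. 0 < Re z}"
      by (intro holomorphic_intros) auto
  qed (use gin in auto)
  have g_in: "g z \<in> h ` unit_disk" if "0 < Re z" for z
    unfolding g_def using gin[OF that] by blast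
  have gf: "g (f w) = w" if w: "w \<in> h ` unit_disk" for w
  proof -
    obtain z where z: "z \<in> unit_disk" "w = h z" using w by blast
    have "\<tau> * (cnj \<tau> * z) = z" by (simp add: mult.assoc[symmetric] tt)
    then show ?thesis
      unfolding z(2) fh[OF z(1)] g_def yac[OF in_disk[OF z(1)]] by (rule arg_cong)
  qed
  have fg: "f (g z) = z" if "0 < Re z" for z
  proof -
    have unrot: "cnj \<tau> * (\<tau> * c) = c" for c by (simp add: mult.assoc[symmetric] tt)
    show ?thesis unfolding g_def fh[OF gin[OF that]] unrot by (rule cay[OF that])
  qed
  have mono: "Re (f w) \<le> Re (f (w + \<i> * of_real s))" if w: "w \<in> h ` unit_disk" and s: "0 \<le> s" for w s
  proof (cases "s = 0")
    case False
    then have s0: "0 < s" using s by simp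
    define b where "b n = f (w + \<i> * of_real (real n * s))" for n :: nat
    obtain z where z: "z \<in> unit_disk" "w = h z" using w by blast
    have "Re (f w) \<le> Re (f (g (f w) + \<i> * of_real s))"
    proof (rule half_plane_Julia[where b = b])
      show "(\<lambda>x. f (g x + \<i> * of_real s)) holomorphic_on {z. 0 < Re z}"
        by (rule holomorphic_on_compose_gen[OF _ holf, unfolded o_def])
           (use star g_in s in \<open>auto intro!: holomorphic_intros holg\<close>)
      show "0 < Re (f (g x + \<i> * of_real s))" if "0 < Re x" for x
        by (rule Rf[OF star[OF g_in[OF that] s]])
      show "0 < Re (b n)" for n
        unfolding b_def by (rule Rf[OF star[OF w]]) (use s in simp)
      show "f (g (b n) + \<i> * of_real s) = b (Suc n)" for n
        using gf[OF star[OF w, of "real n * s"]] s by (simp add: b_def algebra_simps)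
      show "0 < Re (f w)" using Rf[OF w] .
      have "filterlim (\<lambda>n. real n * s) at_top sequentially"
        by (rule filterlim_at_top_mult_tendsto_pos[OF tendsto_const s0 filterlim_real_sequentially])
      then have "(\<lambda>n. \<phi> (real n * s) z) \<longlonglongrightarrow> \<tau>"
        by (rule filterlim_compose[OF lim[OF z(1)]])
      then have "(\<lambda>n. (1 - cnj \<tau> * \<phi> (real n * s) z) / (1 + cnj \<tau> * \<phi> (real n * s) z))
          \<longlonglongrightarrow> (1 - cnj \<tau> * \<tau>) / (1 + cnj \<tau> * \<tau>)"
        by (intro tendsto_intros) (unfold tt, simp_all)
      moreover have "inverse (b n) = (1 - cnj \<tau> * \<phi> (real n * s) z) / (1 + cnj \<tau> * \<phi> (real n * s) z)" for n
        using fshift[OF z(1), of "real n * s"] s z(2) by (simp add: b_def cayley_def)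
      ultimately show "(\<lambda>n. inverse (b n)) \<longlonglongrightarrow> 0" unfolding tt by simp
    qed
    then show ?thesis by (simp add: gf[OF w])
  qed simp
  have "starlike_half_plane_map (h ` unit_disk) f g"
    by (rule starlike_half_plane_map.intro)
       (fact open_mapping_thm3[OF hol open_ball inj] star holf Rf holg g_in gf fg mono)+
  then show thesis using fshift by (rule that)
qed

theorem proposition5p3:
  fixes \<phi> :: "real \<Rightarrow> complex \<Rightarrow> complex" and h :: "complex \<Rightarrow> complex"
    and \<tau> p :: complex and \<Omega> :: "complex set" and \<alpha>m \<alpha>p :: ereal
  assumes "nonelliptic_semigroup \<phi>"
    and "DW_point \<phi> \<tau>"
    and "koenigs_function \<phi> h"
    and "\<Omega> = h ` unit_disk"
    and "p \<in> natural_points \<Omega>"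
    and "\<alpha>m = Liminf at_top (left_extent \<Omega> p)"
    and "\<alpha>p = Liminf at_top (right_extent \<Omega> p)"
  shows "(\<alpha>m > 0 \<and> \<alpha>p > 0 \<longrightarrow>
            (\<forall>z\<in>unit_disk. converges_nontangentially (\<lambda>t. \<phi> t z) \<tau>))
       \<and> (\<alpha>m > 0 \<and> (right_extent \<Omega> p \<longlongrightarrow> 0) at_top \<longrightarrow>
            (\<forall>z\<in>unit_disk. slope_set (\<lambda>t. \<phi> t z) \<tau> = {pi/2}) \<and>
            (\<forall>z\<in>unit_disk. converges_tangentially (\<lambda>t. \<phi> t z) \<tau>))
       \<and> (\<alpha>p > 0 \<and> (left_extent \<Omega> p \<longlongrightarrow> 0) at_top \<longrightarrow>
            (\<forall>z\<in>unit_disk. slope_set (\<lambda>t. \<phi> t z) \<tau> = {-pi/2}) \<and>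
            (\<forall>z\<in>unit_disk. converges_tangentially (\<lambda>t. \<phi> t z) \<tau>))"
proof -
  have sg: "semigroup_in_disk \<phi>" using assms(1) by (simp add: nonelliptic_semigroup_def)
  obtain f g where f: "starlike_half_plane_map \<Omega> f g"
    and fh: "\<And>z t. z \<in> unit_disk \<Longrightarrow> 0 \<le> t \<Longrightarrow> f (h z + \<i> * of_real t) = cayley (cnj \<tau> * \<phi> t z)"
    using koenigs_half_plane_map[OF sg assms(2,3)] assms(4) by metis
  define S where "S = {w. p + w \<in> \<Omega>}"
  \<comment> \<open>T moves p to the origin, and M is the reflection of T that turns the last assertion into the second one.\<close>
  interpret F: starlike_half_plane_map \<Omega> f g by (rule f)
  interpret T: starlike_half_plane_map S "\<lambda>w. f (p + w)" "\<lambda>z. g z - p"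
    unfolding S_def by (rule F.translate)
  interpret M: starlike_half_plane_map "{w. - cnj w \<in> S}" "\<lambda>w. cnj (f (p + - cnj w))" "\<lambda>z. - cnj (g (cnj z) - p)"
    by (rule T.mirror)
  have l: "left_extent \<Omega> p = left_extent S 0" and r: "right_extent \<Omega> p = right_extent S 0"
    unfolding S_def by (rule ext, rule left_extent_translate, rule ext, rule right_extent_translate)
  have ml: "right_extent S 0 = left_extent {w. - cnj w \<in> S} 0"
    and mr: "left_extent S 0 = right_extent {w. - cnj w \<in> S} 0"
    by (rule ext, rule right_extent_mirror, rule ext, rule left_extent_mirror)
  have start: "h z - p \<in> S" if "z \<in> unit_disk" for z using that assms(4) by (simp add: S_def)
  have traj: "f (p + (h z - p + \<i> * of_real t)) = cayley (cnj \<tau> * \<phi> t z)"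
    if "z \<in> unit_disk" "0 \<le> t" for z t
    using fh[OF that] by (simp add: algebra_simps)
  have inside: "norm (cnj \<tau> * \<phi> t z) < 1" if "z \<in> unit_disk" "0 \<le> t" for z t
  proof -
    have "\<phi> t z \<in> unit_disk" using sg that unfolding semigroup_in_disk_def by blast
    moreover have "norm \<tau> = 1" using assms(2) by (simp add: DW_point_def)
    ultimately show ?thesis by (simp add: norm_mult)
  qed
  have lim: "((\<lambda>t. \<phi> t z) \<longlongrightarrow> \<tau>) at_top" if "z \<in> unit_disk" for z
    using assms(2) that by (simp add: DW_point_def)
  have low: "Re (f (h z)) \<le> Re (cayley (cnj \<tau> * \<phi> t z))" if "z \<in> unit_disk" "0 \<le> t" for z t
    using F.Re_mono[of "h z" t] fh[OF that] that assms(4) by auto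
  have low_pos: "0 < Re (f (h z))" if "z \<in> unit_disk" for z
    using F.Re_pos[of "h z"] that assms(4) by simp
  have A: "converges_nontangentially (\<lambda>t. \<phi> t z) \<tau>"
    if ext: "0 < \<alpha>m" "0 < \<alpha>p" and z: "z \<in> unit_disk" for z
  proof -
    obtain K where "\<forall>\<^sub>F t in at_top. \<bar>Im (f (p + (h z - p + \<i> * of_real t)))\<bar>
        \<le> K * Re (f (p + (h z - p + \<i> * of_real t)))"
      using T.nontangential_of_extents[OF _ _ start[OF z]] ext assms(6,7) l r by auto
    then have "\<forall>\<^sub>F t in at_top. \<bar>Im (cayley (cnj \<tau> * \<phi> t z))\<bar> \<le> K * Re (cayley (cnj \<tau> * \<phi> t z))"
      using eventually_ge_at_top[of 0] by eventually_elim (simp only: traj[OF z])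
    then show ?thesis
      by (intro nontangential_if_cayley_in_sector inside lim z)
  qed
  have B: "slope_set (\<lambda>t. \<phi> t z) \<tau> = {pi/2}"
    if ext: "0 < \<alpha>m" "(right_extent \<Omega> p \<longlongrightarrow> 0) at_top" and z: "z \<in> unit_disk" for z
  proof -
    have "\<forall>\<^sub>F t in at_top. 1 * Im (cayley (cnj \<tau> * \<phi> t z)) \<le> - M * Re (cayley (cnj \<tau> * \<phi> t z))" for M
    proof -
      have "\<forall>\<^sub>F t in at_top. Im (f (p + (h z - p + \<i> * of_real t))) \<le> - M * Re (f (p + (h z - p + \<i> * of_real t)))"
        using T.tangential_of_extents[OF _ _ start[OF z]] ext assms(6) l r by simp
      then show ?thesis
        using eventually_ge_at_top[of 0] by eventually_elim (simp only: traj[OF z] mult_1)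
    qed
    from slope_set_if_cayley_tangential[of 1, OF _ inside[OF z] low_pos[OF z] low[OF z] this]
    show ?thesis by simp
  qed
  have C: "slope_set (\<lambda>t. \<phi> t z) \<tau> = {-pi/2}"
    if ext: "0 < \<alpha>p" "(left_extent \<Omega> p \<longlongrightarrow> 0) at_top" and z: "z \<in> unit_disk" for z
  proof -
    have "\<forall>\<^sub>F t in at_top. -1 * Im (cayley (cnj \<tau> * \<phi> t z)) \<le> - M * Re (cayley (cnj \<tau> * \<phi> t z))" for M
    proof -
      have refl: "p + - cnj (- cnj (h z - p) + \<i> * of_real t) = p + (h z - p + \<i> * of_real t)" for t
        by simp
      have "- cnj (h z - p) \<in> {w. - cnj w \<in> S}" using start[OF z] by simp
      then have "\<forall>\<^sub>F t in at_top. Im (cnj (f (p + - cnj (- cnj (h z - p) + \<i> * of_real t))))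
          \<le> - M * Re (cnj (f (p + - cnj (- cnj (h z - p) + \<i> * of_real t))))"
        by (intro M.tangential_of_extents) (use ext assms(7) l r ml mr in simp_all)
      then show ?thesis unfolding refl
        using eventually_ge_at_top[of 0] by eventually_elim (simp add: fh[OF z])
    qed
    from slope_set_if_cayley_tangential[of "-1", OF _ inside[OF z] low_pos[OF z] low[OF z] this]
    show ?thesis by simp
  qed
  have tang: "converges_tangentially (\<lambda>t. \<phi> t z) \<tau>"
    if "slope_set (\<lambda>t. \<phi> t z) \<tau> = {pi/2} \<or> slope_set (\<lambda>t. \<phi> t z) \<tau> = {-pi/2}" "z \<in> unit_disk" for z
    using that lim by (auto simp: converges_tangentially_def)
  show ?thesis using A B C tang by blast
qed

end
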